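(* Let $m \ge 1$ and $0 \le k \le m-1$ be integers, and let $f : [0,\infty) \times \mathbb{R}^m \to [0,\infty)$ be a non-negative locally Caratheodory function. Let $q : [0,\infty) \to [0,\infty)$ be a locally integrable function, and let $h : [0,\infty) \to [0,\infty)$ be a non-decreasing continuous function such that $h(s) > 0$ for all $s \in (0,\infty)$. Suppose that $$f(t, x_0, \ldots, x_{m-1}) \le q(t)\, h(x_k)$$ for almost all $t \in [0,\infty)$ and for all $x_i \in [0,\infty)$, $i = 0, \ldots, m-1$, and that $$\int_1^\infty h^{-1/(m-k)}(s)\, s^{1/(m-k) - 1}\, ds = \infty.$$ Then for all real numbers $a_0, \ldots, a_{m-1} \ge 0$ the Cauchy problem $$w^{(m)} = f(t, w, \ldots, w^{(m-1)}), \qquad w^{(i)}(0) = a_i, \quad i = 0, \ldots, m-1,$$ has a global solution, i.e. a solution on the whole interval $[0,\infty)$.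
   Context: A function $f : [0,\infty) \times \mathbb{R}^m \to \mathbb{R}$ is locally Caratheodory if $f(\cdot, x)$ is measurable for every $x \in \mathbb{R}^m$, $f(t,\cdot)$ is continuous for almost all $t \in [0,\infty)$, and for every $r > 0$ the function $t \mapsto \sup_{|x| \le r} |f(t,x)|$ is bounded almost everywhere by a locally integrable function on $[0,\infty)$. Locally integrable on $[0,\infty)$ means Lebesgue integrable on $[0,b]$ for every $b > 0$. A function $w : [0,T) \to \mathbb{R}$, $0 < T \le \infty$, is called a solution of the equation $w^{(m)} = f(t, w, \ldots, w^{(m-1)})$ on $[0,T)$ if its derivatives $w^{(i)}$, $i = 0, \ldots, m-1$, are locally absolutely continuous on $[0,T)$ and the equation holds for almost all $t \in [0,T)$. It is a solution of the Cauchy problem if, in addition, it satisfies the initial conditions. *)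

theory Defs
  imports "HOL-Analysis.Analysis"
begin

definition locally_integrable :: "(real \<Rightarrow> real) \<Rightarrow> bool" where
  "locally_integrable q \<longleftrightarrow> (\<forall>b>0. q absolutely_integrable_on {0..b})"

text \<open>
  The space of \<open>m\<close>-tuples of reals is \<^const>\<open>Euclidean_space\<close>\<open> m\<close>: its points are the functions
  \<open>x :: nat \<Rightarrow> real\<close> with \<open>x i = 0\<close> for \<open>i \<ge> m\<close>, and the coordinates are \<open>x 0, \<dots>, x (m - 1)\<close>.
  Only the values of \<open>f t x\<close> for \<open>t \<ge> 0\<close> and \<open>x\<close> in that space matter.
  The supremum is taken in \<^typ>\<open>ereal\<close>, so that it is meaningful even for an unbounded set.
\<close>

definition locally_Caratheodory :: "nat \<Rightarrow> (real \<Rightarrow> (nat \<Rightarrow> real) \<Rightarrow> real) \<Rightarrow> bool" where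
  "locally_Caratheodory m f \<longleftrightarrow>
     (\<forall>x\<in>topspace (Euclidean_space m). (\<lambda>t. f t x) \<in> borel_measurable (lebesgue_on {0..})) \<and>
     (AE t in lebesgue_on {0..}. continuous_map (Euclidean_space m) euclideanreal (f t)) \<and>
     (\<forall>r>0. \<exists>g. locally_integrable g \<and>
        (AE t in lebesgue_on {0..}.
           (SUP x\<in>{x\<in>topspace (Euclidean_space m). L2_set x {..<m} \<le> r}. ereal \<bar>f t x\<bar>)
             \<le> ereal (g t)))"

definition abs_continuous_on :: "real set \<Rightarrow> (real \<Rightarrow> real) \<Rightarrow> bool" where
  "abs_continuous_on S f \<longleftrightarrow>
     (\<forall>\<epsilon>>0. \<exists>\<delta>>0. \<forall>(n::nat) u v.
        (\<forall>i<n. u i \<le> v i \<and> {u i..v i} \<subseteq> S) \<and>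
        disjoint_family_on (\<lambda>i. {u i<..<v i}) {..<n} \<and>
        (\<Sum>i<n. v i - u i) < \<delta> \<longrightarrow>
        (\<Sum>i<n. \<bar>f (v i) - f (u i)\<bar>) < \<epsilon>)"

definition locally_abs_continuous_on :: "real set \<Rightarrow> (real \<Rightarrow> real) \<Rightarrow> bool" where
  "locally_abs_continuous_on S f \<longleftrightarrow> (\<forall>a b. {a..b} \<subseteq> S \<longrightarrow> abs_continuous_on {a..b} f)"

text \<open>
  The \<open>i\<close>-th derivative relative to \<open>S\<close>, hence one-sided at an end point belonging to \<open>S\<close>.
  It is the true derivative only where the preceding derivatives are differentiable,
  which has to be required separately.
\<close>

primrec nth_derivative_on :: "real set \<Rightarrow> nat \<Rightarrow> (real \<Rightarrow> real) \<Rightarrow> real \<Rightarrow> real" where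
  "nth_derivative_on S 0 w = w"
| "nth_derivative_on S (Suc i) w =
     (\<lambda>t. vector_derivative (nth_derivative_on S i w) (at t within S))"

definition right_open_interval :: "ereal \<Rightarrow> real set" where
  "right_open_interval T = {t. 0 \<le> t \<and> ereal t < T}"

definition jet :: "real set \<Rightarrow> nat \<Rightarrow> (real \<Rightarrow> real) \<Rightarrow> real \<Rightarrow> nat \<Rightarrow> real" where
  "jet S m w t = (\<lambda>i. if i < m then nth_derivative_on S i w t else 0)"

text \<open>
  The last clause states both that the derivative of order \<open>m\<close> exists at almost every \<open>t\<close>
  and that it equals the right-hand side. It is only meant for \<open>m \<ge> 1\<close>.
\<close>

definition is_solution ::
  "nat \<Rightarrow> (real \<Rightarrow> (nat \<Rightarrow> real) \<Rightarrow> real) \<Rightarrow> ereal \<Rightarrow> (real \<Rightarrow> real) \<Rightarrow> bool" where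
  "is_solution m f T w \<longleftrightarrow>
     (let S = right_open_interval T in
        0 < T \<and>
        (\<forall>i. Suc i < m \<longrightarrow> nth_derivative_on S i w differentiable_on S) \<and>
        (\<forall>i<m. locally_abs_continuous_on S (nth_derivative_on S i w)) \<and>
        (AE t in lebesgue_on S.
           (nth_derivative_on S (m - 1) w has_real_derivative f t (jet S m w t)) (at t within S)))"

definition is_Cauchy_solution ::
  "nat \<Rightarrow> (real \<Rightarrow> (nat \<Rightarrow> real) \<Rightarrow> real) \<Rightarrow> (nat \<Rightarrow> real) \<Rightarrow> ereal \<Rightarrow> (real \<Rightarrow> real) \<Rightarrow> bool" where
  "is_Cauchy_solution m f a T w \<longleftrightarrow>
     is_solution m f T w \<and>
     (\<forall>i<m. nth_derivative_on (right_open_interval T) i w 0 = a i)"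

end

theory Submission
  imports Defs "HOL-Complex_Analysis.Great_Picard"
begin

text \<open>
  All data of the problem are non-negative, so \<open>w\<close> and its derivatives of order below \<open>m\<close> are
  non-negative and non-decreasing, and the only obstacle to a global solution is blow-up in finite
  time. The proof first excludes blow-up for a class of functions wide enough to contain both
  solutions and approximate solutions. It then constructs approximate solutions on the whole
  half-line, so that their limit is a global solution and nothing has to be continued.

  \<^emph>\<open>A priori bound.\<close> Put \<open>N = m - k\<close> and \<open>v\<^sub>i = w\<^sup>(\<^sup>k\<^sup>+\<^sup>i\<^sup>)\<close>. Then \<open>v\<^sub>i' = v\<^sub>i\<^sub>+\<^sub>1\<close> and
  \<open>v\<^sub>N\<^sub>-\<^sub>1' \<le> q h(v\<^sub>0)\<close>. With the rate \<open>\<lambda>(s) = (h(s) / s)\<^bsup>1/N\<^esup>\<close> the profile \<open>B\<^sub>i(s) = s \<lambda>(s)\<^sup>i\<close>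
  satisfies \<open>B\<^sub>N = h\<close> and \<open>B\<^sub>i(2s) \<ge> 2\<^bsup>1/N\<^esup> B\<^sub>i(s)\<close> for \<open>i < N\<close>, because \<open>h\<close> is non-decreasing.
  Measure time by the clock \<open>Q(t) = t + \<integral>\<^sub>0\<^sup>t q\<close>. If \<open>v\<^sub>i \<le> B\<^sub>i(s)\<close> for all \<open>i < N\<close> at some moment,
  then integrating the inequalities once shows that \<open>v\<^sub>i \<le> B\<^sub>i(2s)\<close> persists until the clock has
  advanced by a fixed multiple of \<open>1 / \<lambda>(2s)\<close> (lemma \<open>cascade_step\<close>). Along \<open>s = 2\<^sup>j\<close> these advances
  form a series which diverges by comparison with the integral in the hypothesis (lemma
  \<open>inverse_rate_not_summable\<close>). Hence every clock value is covered after finitely many doublings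
  (lemma \<open>cascade_bounded\<close>).

  \<^emph>\<open>Existence.\<close> Write the equation as a first order system and freeze the state at the nodes of a
  grid of mesh \<open>d\<close> (Euler's method). The polygons are defined for all \<open>t \<ge> 0\<close>, obey the a priori
  bound uniformly in \<open>d\<close>, and are therefore equicontinuous with respect to the clock. A subsequence
  converges pointwise and dominated convergence turns the limit into a solution of the integral
  equation (lemma \<open>integral_equation_solvable\<close>). Absolute continuity and Lebesgue's differentiation
  theorem give back the differential equation (lemma \<open>solution_of_integral_equation\<close>).
\<close>

section \<open>Primitives of integrable functions\<close>

lemma continuous_on_Ici:
  fixes w :: "real \<Rightarrow> real"
  assumes "\<And>b. continuous_on {0..b} w"
  shows "continuous_on {0..} w"
  unfolding continuous_on_eq_continuous_within
proof
  fix t :: real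
  assume t: "t \<in> {0..}"
  have "at t within {0..} = at t within {0..t + 1}"
    by (rule at_within_nhd[of t "{..<t + 1}"]) auto
  moreover have "continuous (at t within {0..t + 1}) w"
    using assms[of "t + 1"] t by (simp add: continuous_on_eq_continuous_within)
  ultimately show "continuous (at t within {0..}) w" by (simp add: continuous_within)
qed

lemma sum_indicator_disjoint_le:
  fixes c :: real
  assumes "finite I" "disjoint_family_on A I" "0 \<le> c"
  shows "(\<Sum>i\<in>I. if t \<in> A i then c else 0) \<le> c"
proof (cases "\<exists>i\<in>I. t \<in> A i")
  case True
  then obtain j where j: "j \<in> I" "t \<in> A j" by blast
  have "(\<Sum>i\<in>I. if t \<in> A i then c else 0) = (\<Sum>i\<in>I. if i = j then c else 0)"
    using j assms(2) by (intro sum.cong) (auto simp: disjoint_family_on_def)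
  then show ?thesis using j assms(1) by simp
next
  case False
  then show ?thesis using assms(3) by (simp add: sum.neutral)
qed

text \<open>
  The intervals may share end points. Passing to their interiors, which leaves the integrals
  unchanged, makes them disjoint.
\<close>

lemma sum_integral_disjoint_le:
  fixes e :: "real \<Rightarrow> real" and u v :: "nat \<Rightarrow> real"
  assumes e: "e integrable_on {a..b}" "\<And>t. 0 \<le> e t"
    and sub: "\<And>i. i < n \<Longrightarrow> {u i..v i} \<subseteq> {a..b}"
    and disj: "disjoint_family_on (\<lambda>i. {u i<..<v i}) {..<n}"
  shows "(\<Sum>i<n. integral {u i..v i} e) \<le> integral {a..b} e"
proof -
  define E where "E i t = (if t \<in> {u i<..<v i} then e t else 0)" for i :: nat and t
  have sub': "{u i<..<v i} \<subseteq> {a..b}" if "i < n" for i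
    using sub[OF that] greaterThanLessThan_subseteq_atLeastAtMost_iff[of "u i" "v i" "u i" "v i"] by auto
  have e_int: "e integrable_on {u i<..<v i}" if "i < n" for i
    using integrable_on_subinterval[OF e(1) sub[OF that]] integrable_on_open_interval_real by blast
  have Int: "{u i<..<v i} \<inter> {a..b} = {u i<..<v i}" if "i < n" for i
    using sub'[OF that] by blast
  have E_int: "E i integrable_on {a..b}" if "i < n" for i
    unfolding E_def integrable_restrict_Int Int[OF that] by (rule e_int[OF that])
  have "(\<Sum>i<n. integral {u i..v i} e) = (\<Sum>i<n. integral {a..b} (E i))"
  proof (rule sum.cong)
    fix i assume "i \<in> {..<n}"
    then have "integral {a..b} (E i) = integral {u i<..<v i} e"
      unfolding E_def integral_restrict_Int by (simp add: Int)
    then show "integral {u i..v i} e = integral {a..b} (E i)"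
      by (simp add: integral_open_interval_real)
  qed simp
  also have "\<dots> = integral {a..b} (\<lambda>t. \<Sum>i<n. E i t)"
    using E_int by (intro integral_sum[symmetric]) auto
  also have "\<dots> \<le> integral {a..b} e"
  proof (rule integral_le[OF integrable_sum])
    show "(\<Sum>i<n. E i t) \<le> e t" for t
      unfolding E_def using e(2) by (intro sum_indicator_disjoint_le[OF _ disj]) simp_all
  qed (use E_int e in auto)
  finally show ?thesis .
qed

text \<open>
  Truncation: \<open>\<bar>g\<bar> \<le> max (\<bar>g\<bar> - K) 0 + K\<close>. The first summand has integral below \<open>\<epsilon> / 2\<close> over the
  whole interval once \<open>K\<close> is large. The second contributes at most \<open>K\<close> times the total length.
\<close>

lemma primitive_abs_continuous:
  fixes g :: "real \<Rightarrow> real"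
  assumes g: "g absolutely_integrable_on {a..b}"
    and w: "\<And>s t. a \<le> s \<Longrightarrow> s \<le> t \<Longrightarrow> t \<le> b \<Longrightarrow> w t - w s = integral {s..t} g"
  shows "abs_continuous_on {a..b} w"
  unfolding abs_continuous_on_def
proof (intro allI impI)
  fix \<epsilon> :: real
  assume "0 < \<epsilon>"
  define e where "e k t = max (\<bar>g t\<bar> - real k) 0" for k :: nat and t
  have e_abs: "e k absolutely_integrable_on {a..b}" for k
    unfolding e_def using g
    by (intro absolutely_integrable_max_1 set_integral_diff set_integrable_abs) auto
  then have e_int: "e k integrable_on {a..b}" for k by (rule set_lebesgue_integral_eq_integral)
  have abs_int: "(\<lambda>t. \<bar>g t\<bar>) integrable_on {a..b}"
    using set_integrable_abs[OF g] by (rule set_lebesgue_integral_eq_integral)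
  have "(\<lambda>k. integral {a..b} (e k)) \<longlonglongrightarrow> integral {a..b} (\<lambda>t. 0)"
  proof (rule dominated_convergence(2)[OF e_int abs_int])
    fix t
    obtain K where K: "\<bar>g t\<bar> \<le> real K" using real_arch_simple by blast
    have "\<forall>\<^sub>F k in sequentially. e k t = 0"
      using K by (intro eventually_sequentiallyI[of K]) (simp add: e_def)
    then show "(\<lambda>k. e k t) \<longlonglongrightarrow> 0" by (rule tendsto_eventually)
  qed (simp add: e_def)
  then have "\<forall>\<^sub>F k in sequentially. integral {a..b} (e k) < \<epsilon> / 2"
    using \<open>0 < \<epsilon>\<close> by (intro order_tendstoD) auto
  then obtain k where k: "integral {a..b} (e k) < \<epsilon> / 2" by (meson eventually_happens' sequentially_bot)
  \<comment> \<open>\<open>k + 1\<close> in place of \<open>k\<close> only avoids division by zero.\<close>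
  define \<delta> where "\<delta> = \<epsilon> / (2 * (real k + 1))"
  have "(\<Sum>i<n. \<bar>w (v i) - w (u i)\<bar>) < \<epsilon>"
    if uv: "\<forall>i<n. u i \<le> v i \<and> {u i..v i} \<subseteq> {a..b}"
      and disj: "disjoint_family_on (\<lambda>i. {u i<..<v i}) {..<n}"
      and small: "(\<Sum>i<n. v i - u i) < \<delta>" for n and u v :: "nat \<Rightarrow> real"
  proof -
    have le: "\<bar>w (v i) - w (u i)\<bar> \<le> integral {u i..v i} (e k) + real k * (v i - u i)" if i: "i < n" for i
    proof -
      have i': "u i \<le> v i" "{u i..v i} \<subseteq> {a..b}" using uv i by auto
      have gi: "g integrable_on {u i..v i}"
        using set_lebesgue_integral_eq_integral(1)[OF g] i'(2) by (rule integrable_on_subinterval)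
      have ei: "e k integrable_on {u i..v i}" using e_int i'(2) by (rule integrable_on_subinterval)
      have "\<bar>integral {u i..v i} g\<bar> \<le> integral {u i..v i} (\<lambda>t. e k t + real k)"
      proof -
        have "(\<lambda>t. e k t + real k) integrable_on {u i..v i}" by (intro integrable_add ei integrable_const_ivl)
        then have "norm (integral {u i..v i} g) \<le> integral {u i..v i} (\<lambda>t. e k t + real k)"
          by (rule integral_norm_bound_integral[OF gi]) (auto simp: e_def)
        then show ?thesis by simp
      qed
      also have "\<dots> = integral {u i..v i} (e k) + real k * (v i - u i)"
        using ei i' by (subst integral_add) auto
      finally show ?thesis using w[of "u i" "v i"] i' by auto
    qed
    have "(\<Sum>i<n. \<bar>w (v i) - w (u i)\<bar>) \<le> (\<Sum>i<n. integral {u i..v i} (e k) + real k * (v i - u i))"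
      using le by (intro sum_mono) auto
    also have "\<dots> = (\<Sum>i<n. integral {u i..v i} (e k)) + real k * (\<Sum>i<n. v i - u i)"
      by (simp add: sum.distrib sum_distrib_left)
    also have "\<dots> \<le> integral {a..b} (e k) + real k * \<delta>"
      using sum_integral_disjoint_le[OF e_int _ _ disj] uv small
      by (intro add_mono mult_left_mono) (auto simp: e_def)
    also have "real k * \<delta> \<le> (real k + 1) * \<delta>"
      using \<open>0 < \<epsilon>\<close> by (intro mult_right_mono) (auto simp: \<delta>_def)
    also have "integral {a..b} (e k) + (real k + 1) * \<delta> < \<epsilon>"
    proof -
      have "(real k + 1) * \<delta> = \<epsilon> / 2" by (simp add: \<delta>_def field_simps)
      then show ?thesis using k by simp
    qed
    finally show ?thesis by simp
  qed
  moreover have "0 < \<delta>" using \<open>0 < \<epsilon>\<close> by (simp add: \<delta>_def)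
  ultimately show "\<exists>\<delta>>0. \<forall>(n::nat) u v.
        (\<forall>i<n. u i \<le> v i \<and> {u i..v i} \<subseteq> {a..b}) \<and>
        disjoint_family_on (\<lambda>i. {u i<..<v i}) {..<n} \<and>
        (\<Sum>i<n. v i - u i) < \<delta> \<longrightarrow>
        (\<Sum>i<n. \<bar>w (v i) - w (u i)\<bar>) < \<epsilon>"
    by blast
qed

lemma AE_lebesgue_onI:
  assumes "negligible N" "S \<in> sets lebesgue" "\<And>t. t \<in> S \<Longrightarrow> t \<notin> N \<Longrightarrow> P t"
  shows "AE t in lebesgue_on S. P t"
  using assms by (subst AE_restrict_space_iff)
    (auto simp: negligible_iff_null_sets intro!: AE_I'[of N])

text \<open>
  The one-dimensional case of the Lebesgue differentiation theorem for averages over cubes with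
  their lower corner at the point. In dimension one it yields right derivatives only.
\<close>

lemma integrable_imp_right_derivative_AE:
  fixes f :: "real \<Rightarrow> real"
  assumes "\<And>a b. f integrable_on {a..b}"
  shows "\<exists>N. negligible N \<and> (\<forall>x e. x \<notin> N \<longrightarrow> 0 < e \<longrightarrow>
       (\<exists>d>0. \<forall>r. 0 < r \<and> r < d \<longrightarrow> norm (integral {x..x + r} f /\<^sub>R r - f x) < e))"
proof -
  have "f integrable_on cbox a b" for a b using assms by simp
  then obtain N where N: "negligible N"
    "\<And>x e. x \<notin> N \<Longrightarrow> 0 < e \<Longrightarrow> \<exists>d>0. \<forall>r. 0 < r \<and> r < d \<longrightarrow>
       norm (integral (cbox x (x + r *\<^sub>R \<Sum>Basis)) f /\<^sub>R r ^ DIM(real) - f x) < e"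
    using integrable_ccontinuous_explicit[of f] by metis
  show ?thesis
    using N by (intro exI[of _ N]) (simp add: Basis_real_def)
qed

text \<open>
  Right derivatives come from the differentiation theorem applied to \<open>g\<close>, left derivatives from
  the same theorem applied to the reflected function \<open>g(-t)\<close>.
\<close>

lemma primitive_has_derivative_AE:
  fixes g :: "real \<Rightarrow> real"
  assumes g: "\<And>b. g integrable_on {0..b}"
    and w: "\<And>s t. 0 \<le> s \<Longrightarrow> s \<le> t \<Longrightarrow> w t - w s = integral {s..t} g"
  shows "AE t in lebesgue_on {0..}. (w has_real_derivative g t) (at t within {0..})"
proof -
  \<comment> \<open>The differentiation theorem needs a function integrable on all intervals of the line.\<close>
  define f where "f t = (if t \<in> {0..} then g t else 0)" for t
  have f_int: "f integrable_on {a..b}" for a b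
  proof -
    have "{0..} \<inter> {a..b} = {max 0 a..b}" by auto
    moreover have "g integrable_on {max 0 a..b}"
      using g[of b] by (rule integrable_on_subinterval) auto
    ultimately show ?thesis unfolding f_def by (subst integrable_restrict_Int) simp
  qed
  have f_eq: "integral {s..t} f = integral {s..t} g" if "0 \<le> s" for s t
    using that by (intro integral_cong) (simp add: f_def)
  obtain N where N: "negligible N"
    "\<And>x e. x \<notin> N \<Longrightarrow> 0 < e \<Longrightarrow>
       \<exists>d>0. \<forall>r. 0 < r \<and> r < d \<longrightarrow> norm (integral {x..x + r} f /\<^sub>R r - f x) < e"
    using integrable_imp_right_derivative_AE[of f] f_int by blast
  have "(\<lambda>x. f (- x)) integrable_on {a..b}" for a b
    using f_int[of "- b" "- a"] Henstock_Kurzweil_Integration.integrable_reflect_real[of f "- a" "- b"] by simp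
  then obtain N' where N': "negligible N'"
    "\<And>x e. x \<notin> N' \<Longrightarrow> 0 < e \<Longrightarrow>
       \<exists>d>0. \<forall>r. 0 < r \<and> r < d \<longrightarrow> norm (integral {x..x + r} (\<lambda>x. f (- x)) /\<^sub>R r - f (- x)) < e"
    using integrable_imp_right_derivative_AE[of "\<lambda>x. f (- x)"] by blast
  show ?thesis
  proof (rule AE_lebesgue_onI)
    show "negligible (N \<union> uminus ` N')"
      using N(1) N'(1)
      by (intro negligible_Un negligible_differentiable_image_negligible derivative_intros) auto
    fix t :: real
    assume t: "t \<in> {0..}" "t \<notin> N \<union> uminus ` N'"
    then have t': "0 \<le> t" "t \<notin> N" "- t \<notin> N'" by (auto simp: image_iff)
    show "(w has_real_derivative g t) (at t within {0..})"
      unfolding has_field_derivative_iff Lim_within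
    proof (intro allI impI)
      fix e :: real
      assume "0 < e"
      obtain d where d: "0 < d"
        "\<And>r. 0 < r \<Longrightarrow> r < d \<Longrightarrow> norm (integral {t..t + r} f /\<^sub>R r - f t) < e"
        using N(2)[OF t'(2) \<open>0 < e\<close>] by blast
      obtain d' where d': "0 < d'"
        "\<And>r. 0 < r \<Longrightarrow> r < d' \<Longrightarrow> norm (integral {- t..- t + r} (\<lambda>x. f (- x)) /\<^sub>R r - f t) < e"
        using N'(2)[OF t'(3) \<open>0 < e\<close>] by auto
      have "dist ((w y - w t) / (y - t)) (g t) < e"
        if y: "y \<in> {0..}" "0 < dist y t" "dist y t < min d d'" for y
      proof (cases "t < y")
        case True
        then show ?thesis
          using d(2)[of "y - t"] y t'(1) w[of t y] f_eq[of t y]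
          by (simp add: dist_real_def f_def divide_inverse mult.commute)
      next
        case False
        then have yt: "y < t" using y by auto
        have "integral {- t..- y} (\<lambda>x. f (- x)) = integral {y..t} f" by simp
        moreover have "(w y - w t) / (y - t) = (w t - w y) / (t - y)"
          by (metis minus_diff_eq minus_divide_divide)
        ultimately show ?thesis
          using d'(2)[of "t - y"] yt y t'(1) w[of y t] f_eq[of y t]
          by (simp add: dist_real_def f_def divide_inverse mult.commute)
      qed
      then show "\<exists>d>0. \<forall>y\<in>{0..}. 0 < dist y t \<and> dist y t < d \<longrightarrow>
          dist ((w y - w t) / (y - t)) (g t) < e"
        using d(1) d'(1) by (intro exI[of _ "min d d'"]) auto
    qed
  qed simp
qed

text \<open>
  A derivative relative to the half-line depends on values in the half-line only. Elsewhere the two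
  sides may differ, so the induction compares them for \<open>t \<ge> 0\<close>.
\<close>

lemma nth_derivative_on_Ici_eq:
  assumes x: "\<And>i t. Suc i < m \<Longrightarrow> 0 \<le> t \<Longrightarrow> (x i has_vector_derivative x (Suc i) t) (at t within {0..})"
    and "i < m" "0 \<le> t"
  shows "nth_derivative_on {0..} i (x 0) t = x i t"
  using assms(2,3)
proof (induction i arbitrary: t)
  case (Suc i)
  have "(nth_derivative_on {0..} i (x 0) has_vector_derivative x (Suc i) t) (at t within {0..})"
  proof (rule has_vector_derivative_transform)
    show "(x i has_vector_derivative x (Suc i) t) (at t within {0..})" by (rule x[OF Suc.prems])
    show "nth_derivative_on {0..} i (x 0) s = x i s" if "s \<in> {0..}" for s
      using that Suc.prems(1) by (intro Suc.IH) simp_all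
  qed (use Suc.prems(2) in simp)
  moreover have "at t within {0..} \<noteq> bot"
  proof (cases "t = 0")
    case True
    then show ?thesis by (simp add: at_within_Ici_at_right)
  next
    case False
    then have "at t within {0..} = at t" using Suc.prems by (intro at_within_interior) auto
    then show ?thesis by simp
  qed
  ultimately show ?case by (simp add: vector_derivative_within)
qed simp

lemma primitive_diff:
  fixes g :: "real \<Rightarrow> real"
  assumes g: "\<And>t. 0 \<le> t \<Longrightarrow> g integrable_on {0..t}"
    and w: "\<And>t. 0 \<le> t \<Longrightarrow> w t = c + integral {0..t} g" and st: "0 \<le> s" "s \<le> t"
  shows "w t - w s = integral {s..t} g"
  using Henstock_Kurzweil_Integration.integral_combine[OF st g[OF order_trans[OF st]]] w[of s] w[of t] st by simp

lemma primitive_has_vector_derivative: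
  fixes g :: "real \<Rightarrow> real"
  assumes g: "continuous_on {0..} g"
    and w: "\<And>t. 0 \<le> t \<Longrightarrow> w t = c + integral {0..t} g" and t: "0 \<le> t"
  shows "(w has_vector_derivative g t) (at t within {0..})"
proof (rule has_vector_derivative_transform)
  have "at t within {0..} = at t within {0..t + 1}"
    by (rule at_within_nhd[of t "{..<t + 1}"]) auto
  moreover have "((\<lambda>r. integral {0..r} g) has_vector_derivative g t) (at t within {0..t + 1})"
    using t by (intro integral_has_vector_derivative continuous_on_subset[OF g]) auto
  ultimately show "((\<lambda>r. c + integral {0..r} g) has_vector_derivative g t) (at t within {0..})"
    using has_vector_derivative_add[OF has_vector_derivative_const[of c]] by fastforce
qed (use w t in auto)

section \<open>The growth rate and its dyadic series\<close>

text \<open>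
  The inverse of the time scale attached by dimensional analysis to \<open>v\<^sup>(\<^sup>N\<^sup>) = h(v)\<close> at size
  \<open>v = s\<close>: the equation reads \<open>s \<lambda>\<^sup>N = h(s)\<close> when every derivative counts for a factor \<open>\<lambda>\<close>.
\<close>

definition rate :: "nat \<Rightarrow> (real \<Rightarrow> real) \<Rightarrow> real \<Rightarrow> real" where
  "rate N h s = root N (h s / s)"

lemma rate_pos:
  assumes "1 \<le> N" "0 < s" "0 < h s"
  shows "0 < rate N h s"
  using assms by (simp add: rate_def)

lemma le_suminf_ennreal:
  fixes F :: "nat \<Rightarrow> ennreal"
  shows "F j \<le> (\<Sum>j. F j)"
proof -
  have "sum F {j} \<le> suminf F" by (rule sum_le_suminf) (rule summableI, simp_all)
  then show ?thesis by (simp only: sum.insert[OF finite.emptyI] sum.empty empty_iff not_False_eq_True add_0_right)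
qed

text \<open>
  The integrand is non-increasing, so on \<open>[2\<^sup>j, 2\<^sup>j\<^sup>+\<^sup>1)\<close> it is at most its value at \<open>2\<^sup>j\<close>, and this
  value times the length \<open>2\<^sup>j\<close> is exactly the \<open>j\<close>-th term of the series. A convergent series would
  make the integral finite.
\<close>

lemma inverse_rate_not_summable:
  fixes h :: "real \<Rightarrow> real"
  assumes N: "1 \<le> N" and mono: "mono_on {0..} h" and pos: "\<And>s. 0 < s \<Longrightarrow> 0 < h s"
    and div: "(\<integral>\<^sup>+s\<in>{1..}. ennreal (h s powr (- (1 / real N)) * s powr (1 / real N - 1))
           \<partial>lborel) = \<infinity>"
  shows "\<not> summable (\<lambda>j. 1 / rate N h (2 ^ j))"
proof
  define c where "c j = 1 / rate N h (2 ^ j)" for j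
  define \<phi> where "\<phi> s = h s powr (- (1 / real N)) * s powr (1 / real N - 1)" for s
  define D :: "nat \<Rightarrow> real set" where "D j = {2 ^ j..<2 ^ Suc j}" for j
  have c_pos: "0 < c j" for j
    unfolding c_def using rate_pos[of N "2 ^ j" h] N pos by simp
  assume "summable (\<lambda>j. 1 / rate N h (2 ^ j))"
  then have sm: "summable c" by (simp add: c_def[abs_def])
  have le: "\<phi> s \<le> c j / 2 ^ j" if s: "s \<in> D j" for s j
  proof -
    have s': "2 ^ j \<le> s" "0 < s" using s by (auto simp: D_def intro: less_le_trans[of 0 "2 ^ j"])
    have hj: "0 < h (2 ^ j)" "h (2 ^ j) \<le> h s"
      using pos s' by (auto intro: mono_onD[OF mono])
    have "h s powr (- (1 / real N)) \<le> h (2 ^ j) powr (- (1 / real N))"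
      using hj by (intro powr_mono2') auto
    moreover have "s powr (1 / real N - 1) \<le> (2 ^ j) powr (1 / real N - 1)"
      using s' N by (intro powr_mono2') (auto simp: field_simps)
    ultimately have "\<phi> s \<le> h (2 ^ j) powr (- (1 / real N)) * (2 ^ j) powr (1 / real N - 1)"
      unfolding \<phi>_def by (intro mult_mono) auto
    also have "\<dots> = (2 ^ j / h (2 ^ j)) powr (1 / real N) / 2 ^ j"
    proof -
      have "(2 ^ j :: real) powr (1 / real N - 1) = (2 ^ j) powr (1 / real N) / 2 ^ j"
        by (subst powr_diff) simp
      then show ?thesis using hj by (simp add: powr_minus powr_divide field_simps)
    qed
    also have "(2 ^ j / h (2 ^ j)) powr (1 / real N) = c j"
      unfolding c_def rate_def using N hj by (simp add: root_powr_inverse powr_divide)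
    finally show ?thesis .
  qed
  have "(\<integral>\<^sup>+s\<in>{1..}. ennreal (\<phi> s) \<partial>lborel)
      \<le> (\<integral>\<^sup>+s. (\<Sum>j. ennreal (c j / 2 ^ j) * indicator (D j) s) \<partial>lborel)"
  proof (rule nn_integral_mono)
    fix s :: real
    show "ennreal (\<phi> s) * indicator {1..} s \<le> (\<Sum>j. ennreal (c j / 2 ^ j) * indicator (D j) s)"
    proof (cases "1 \<le> s")
      case True
      obtain n where n: "s < 2 ^ n" using real_arch_pow[of 2 s] by auto
      \<comment> \<open>The dyadic interval containing \<open>s\<close> ends at the first power of two beyond \<open>s\<close>.\<close>
      define p where "p = (LEAST n. s < 2 ^ n)"
      have p: "s < 2 ^ p" unfolding p_def using n by (rule LeastI)
      have "p \<noteq> 0" using p True by (intro notI) simp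
      then obtain j where j: "p = Suc j" using not0_implies_Suc by blast
      have "\<not> s < 2 ^ j"
        using not_less_Least[of j "\<lambda>n. s < 2 ^ n"] j unfolding p_def by simp
      then have sD: "s \<in> D j" using p j by (auto simp: D_def)
      have "ennreal (\<phi> s) * indicator {1..} s \<le> ennreal (c j / 2 ^ j) * indicator (D j) s"
        using le[OF sD] sD True by (simp add: ennreal_leI)
      also have "\<dots> \<le> (\<Sum>j. ennreal (c j / 2 ^ j) * indicator (D j) s)"
        by (rule le_suminf_ennreal)
      finally show ?thesis .
    qed simp
  qed
  also have "\<dots> = (\<Sum>j. \<integral>\<^sup>+s. ennreal (c j / 2 ^ j) * indicator (D j) s \<partial>lborel)"
    by (rule nn_integral_suminf) (simp add: D_def)
  also have "\<dots> = (\<Sum>j. ennreal (c j))"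
  proof (rule arg_cong[where f = suminf], rule ext)
    fix j
    have "ennreal (c j / 2 ^ j) * ennreal (2 ^ j) = ennreal (c j)"
      using c_pos[of j] by (simp flip: ennreal_mult)
    then show "(\<integral>\<^sup>+s. ennreal (c j / 2 ^ j) * indicator (D j) s \<partial>lborel) = ennreal (c j)"
      by (simp add: nn_integral_cmult D_def)
  qed
  also have "\<dots> < \<infinity>"
    using suminf_ennreal2[OF less_imp_le[OF c_pos] sm] by (simp only: infinity_ennreal_def ennreal_less_top)
  finally show False using div by (simp add: \<phi>_def)
qed

text \<open>
  The factor \<open>2\<^bsup>-1/N\<^esup>\<close> by which, at least, the profile \<open>s (rate N h s)\<^sup>i\<close> shrinks when \<open>s\<close> is halved,
  for \<open>i < N\<close>.
\<close>

definition half_root :: "nat \<Rightarrow> real" where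
  "half_root N = 1 / root N 2"

text \<open>
  Half of the room that the factor \<open>2\<^bsup>-1/N\<^esup>\<close> leaves below \<open>1\<close>. Taking only half of it makes the
  bounds in the doubling step strict, as its continuity argument requires.
\<close>

definition quantum :: "nat \<Rightarrow> real" where
  "quantum N = (1 - half_root N) / 2"

lemma half_root_bounds:
  assumes "1 \<le> N"
  shows "0 < half_root N" "half_root N < 1" "half_root N ^ N = 1 / 2"
proof -
  have r: "1 < root N 2" using assms by simp
  show "0 < half_root N" "half_root N < 1" using r by (auto simp: half_root_def field_simps)
  show "half_root N ^ N = 1 / 2" using assms by (simp add: half_root_def power_divide)
qed

lemma rate_double:
  assumes N: "1 \<le> N" and mono: "mono_on {0..} h" and s: "0 < s"
  shows "half_root N * rate N h s \<le> rate N h (2 * s)"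
proof -
  have "half_root N * rate N h s = root N (h s / (2 * s))"
    unfolding half_root_def rate_def by (simp add: real_root_divide real_root_mult)
  also have "\<dots> \<le> root N (h (2 * s) / (2 * s))"
    using N s by (intro real_root_le_mono divide_right_mono mono_onD[OF mono]) auto
  finally show ?thesis by (simp add: rate_def)
qed

text \<open>
  Halving \<open>s\<close> costs a factor \<open>1 / 2\<close> in \<open>s\<close> itself and gains at most \<open>2\<^bsup>1/N\<^esup>\<close> in each of the \<open>i\<close>
  factors of the rate. Since \<open>i < N\<close>, a loss of at least \<open>2\<^bsup>-1/N\<^esup>\<close> remains.
\<close>

lemma profile_double:
  assumes N: "1 \<le> N" and mono: "mono_on {0..} h" and pos: "\<And>s. 0 < s \<Longrightarrow> 0 < h s"
    and s: "0 < s" and i: "i < N"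
  shows "s * rate N h s ^ i \<le> half_root N * (2 * s * rate N h (2 * s) ^ i)"
proof -
  let ?\<theta> = "half_root N"
  have \<theta>: "0 < ?\<theta>" "?\<theta> < 1" "?\<theta> ^ N = 1 / 2" using half_root_bounds[OF N] by auto
  have r: "0 < rate N h s" using rate_pos[of N s h, OF N s pos[OF s]] .
  have "1 / 2 \<le> ?\<theta> ^ Suc i"
    using power_decreasing[of "Suc i" N ?\<theta>] i \<theta> by simp
  then have "1 * (s * rate N h s ^ i) \<le> (2 * ?\<theta> ^ Suc i) * (s * rate N h s ^ i)"
    using s r by (intro mult_right_mono) auto
  also have "\<dots> = ?\<theta> * (2 * s * (?\<theta> * rate N h s) ^ i)" by (simp add: power_mult_distrib)
  also have "\<dots> \<le> ?\<theta> * (2 * s * rate N h (2 * s) ^ i)"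
    using \<theta> s r by (intro mult_left_mono power_mono rate_double[OF N mono s]) auto
  finally show ?thesis by simp
qed

text \<open>
  Each doubling multiplies the profiles by at least \<open>2\<^bsup>1/N\<^esup> > 1\<close>, so they eventually dominate any
  given initial data.
\<close>

lemma ex_dyadic_profile_ge:
  assumes N: "1 \<le> N" and mono: "mono_on {0..} h" and pos: "\<And>s. 0 < s \<Longrightarrow> 0 < h s"
  shows "\<exists>p. \<forall>i<N. a i \<le> 2 ^ p * rate N h (2 ^ p) ^ i"
proof -
  have b: "1 < root N 2" using N by simp
  have "\<forall>\<^sub>F p in sequentially. a i \<le> 2 ^ p * rate N h (2 ^ p) ^ i" if i: "i < N" for i
  proof -
    define c where "c = rate N h 1 ^ i"
    have c: "0 < c" unfolding c_def using rate_pos[of N 1 h] N pos by simp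
    have low: "root N 2 ^ p * c \<le> 2 ^ p * rate N h (2 ^ p) ^ i" for p
    proof (induction p)
      case (Suc p)
      have "root N 2 ^ Suc p * c \<le> root N 2 * (2 ^ p * rate N h (2 ^ p) ^ i)"
        using Suc b by simp
      also have "\<dots> \<le> root N 2 * (half_root N * (2 * 2 ^ p * rate N h (2 * 2 ^ p) ^ i))"
        using b by (intro mult_left_mono profile_double[OF N mono pos _ i]) auto
      also have "\<dots> = 2 ^ Suc p * rate N h (2 ^ Suc p) ^ i"
        using b by (simp add: half_root_def)
      finally show ?case .
    qed (simp add: c_def)
    obtain p where "a i / c < root N 2 ^ p" using real_arch_pow[OF b] by blast
    have "a i \<le> root N 2 ^ p' * c" if "p \<le> p'" for p'
    proof -
      have "a i / c \<le> root N 2 ^ p'"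
        using power_increasing[OF that, of "root N 2"] b \<open>a i / c < root N 2 ^ p\<close>
        by (meson less_imp_le order_trans)
      then show ?thesis using c by (simp add: pos_divide_le_eq)
    qed
    then show ?thesis using low by (intro eventually_sequentiallyI[of p]) (meson order_trans)
  qed
  then have "\<forall>\<^sub>F p in sequentially. \<forall>i\<in>{..<N}. a i \<le> 2 ^ p * rate N h (2 ^ p) ^ i"
    by (intro eventually_ball_finite) auto
  then show ?thesis by (auto simp: eventually_sequentially)
qed

section \<open>A priori bounds for cascades of inequalities\<close>

text \<open>
  One clock for both sources of growth: its increment dominates the elapsed time, which drives the
  lower components, and the increment of \<open>\<integral> q\<close>, which drives the top one.
\<close>

definition clock :: "(real \<Rightarrow> real) \<Rightarrow> real \<Rightarrow> real" where
  "clock q t = t + integral {0..t} q"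

lemma locally_integrable_imp_integrable:
  assumes "locally_integrable q" "0 \<le> s"
  shows "q integrable_on {s..t}"
proof -
  have "q absolutely_integrable_on {0..\<bar>t\<bar> + 1}" using assms by (auto simp: locally_integrable_def)
  then have "q integrable_on {0..\<bar>t\<bar> + 1}" by (rule set_lebesgue_integral_eq_integral)
  then show ?thesis by (rule integrable_on_subinterval) (use assms in auto)
qed

lemma clock_diff:
  assumes "locally_integrable q" "0 \<le> s" "s \<le> t"
  shows "clock q t - clock q s = (t - s) + integral {s..t} q"
  using Henstock_Kurzweil_Integration.integral_combine[OF assms(2,3), of q]
    locally_integrable_imp_integrable[OF assms(1), of 0]
  by (simp add: clock_def)

lemma clock_continuous:
  assumes "locally_integrable q"
  shows "continuous_on {0..b} (clock q)"
  unfolding clock_def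
  by (intro continuous_intros indefinite_integral_continuous_1 locally_integrable_imp_integrable[OF assms]) simp

lemma integral_nonneg_of_locally_integrable:
  assumes "locally_integrable q" "\<And>t. 0 \<le> t \<Longrightarrow> 0 \<le> q t" "0 \<le> s"
  shows "0 \<le> integral {s..t} q"
  using assms by (intro integral_nonneg locally_integrable_imp_integrable) auto

lemma clock_mono:
  assumes "locally_integrable q" "\<And>t. 0 \<le> t \<Longrightarrow> 0 \<le> q t" "0 \<le> s" "s \<le> t"
  shows "clock q s \<le> clock q t"
  using clock_diff[OF assms(1,3,4)] integral_nonneg_of_locally_integrable[OF assms(1-3)] assms(4)
  by (smt (verit))

text \<open>
  The integrated inequalities shared by exact solutions (with \<open>u i\<close> the \<open>i\<close>-th derivative) and by
  polygonal approximations. They evaluate the right-hand sides at the later time \<open>t\<close>, which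
  monotonicity permits. This form is insensitive to the delay that a frozen state introduces.
\<close>

definition cascade ::
  "nat \<Rightarrow> nat \<Rightarrow> (real \<Rightarrow> real) \<Rightarrow> (real \<Rightarrow> real) \<Rightarrow> (nat \<Rightarrow> real) \<Rightarrow> (nat \<Rightarrow> real \<Rightarrow> real) \<Rightarrow> bool"
  where
  "cascade m k q h a u \<longleftrightarrow>
     (\<forall>i<m. continuous_on {0..} (u i) \<and> mono_on {0..} (u i) \<and> u i 0 = a i) \<and>
     (\<forall>i s t. Suc i < m \<longrightarrow> 0 \<le> s \<longrightarrow> s \<le> t \<longrightarrow> u i t - u i s \<le> (t - s) * u (Suc i) t) \<and>
     (\<forall>s t. 0 \<le> s \<longrightarrow> s \<le> t \<longrightarrow> u (m - 1) t - u (m - 1) s \<le> integral {s..t} q * h (u k t))"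

lemma cascadeD:
  assumes "cascade m k q h a u"
  shows "i < m \<Longrightarrow> continuous_on {0..} (u i)"
    and "i < m \<Longrightarrow> 0 \<le> s \<Longrightarrow> s \<le> t \<Longrightarrow> u i s \<le> u i t"
    and "i < m \<Longrightarrow> u i 0 = a i"
    and "Suc i < m \<Longrightarrow> 0 \<le> s \<Longrightarrow> s \<le> t \<Longrightarrow> u i t - u i s \<le> (t - s) * u (Suc i) t"
    and "0 \<le> s \<Longrightarrow> s \<le> t \<Longrightarrow> u (m - 1) t - u (m - 1) s \<le> integral {s..t} q * h (u k t)"
  using assms by (auto simp: cascade_def intro: mono_onD)

lemma cascade_nonneg:
  assumes "cascade m k q h a u" "i < m" "0 \<le> a i" "0 \<le> t"
  shows "0 \<le> u i t"
  using cascadeD(2)[OF assms(1,2), of 0 t] cascadeD(3)[OF assms(1,2)] assms(3,4) by simp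

text \<open>
  The components from the \<open>k\<close>-th on form a cascade by themselves, whose growth is governed by its
  own first component.
\<close>

lemma cascade_drop:
  assumes "cascade m k q h a u" "k < m"
  shows "cascade (m - k) 0 q h (\<lambda>i. a (k + i)) (\<lambda>i. u (k + i))"
proof -
  have "k + (m - k - 1) = m - 1" using assms(2) by simp
  then show ?thesis using assms unfolding cascade_def by auto
qed

text \<open>
  The doubling step. With \<open>B\<^sub>i = 2 s \<mu>\<^sup>i\<close> and \<open>\<mu> = rate N h (2 s)\<close>, an advance of the clock by
  \<open>\<epsilon> / \<mu>\<close> increases component \<open>i\<close> by at most \<open>(\<epsilon> / \<mu>) B\<^sub>i\<^sub>+\<^sub>1 = \<epsilon> B\<^sub>i\<close>, provided that component \<open>i + 1\<close>
  is still below \<open>B\<^sub>i\<^sub>+\<^sub>1\<close>; for the top component \<open>B\<^sub>N = h(2 s)\<close> takes this role. So the bounds are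
  proved from the top component downwards. They presuppose \<open>v\<^sub>0 \<le> 2 s\<close>, and reproduce it with
  strict inequality, so by continuity it cannot fail first.
\<close>

lemma cascade_step:
  assumes N: "1 \<le> N" and mono: "mono_on {0..} h" and pos: "\<And>s. 0 < s \<Longrightarrow> 0 < h s"
    and h0: "\<And>s. 0 \<le> s \<Longrightarrow> 0 \<le> h s" and q: "locally_integrable q" "\<And>t. 0 \<le> t \<Longrightarrow> 0 \<le> q t"
    and v: "cascade N 0 q h a v" and a: "\<And>i. i < N \<Longrightarrow> 0 \<le> a i"
    and s: "0 < s" and t: "0 \<le> t\<^sub>0" "t\<^sub>0 \<le> t"
    and start: "\<And>i. i < N \<Longrightarrow> v i t\<^sub>0 \<le> s * rate N h s ^ i"
    and short: "clock q t - clock q t\<^sub>0 \<le> quantum N / rate N h (2 * s)"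
    and i: "i < N"
  shows "v i t \<le> 2 * s * rate N h (2 * s) ^ i"
proof -
  define \<theta> where "\<theta> = half_root N"
  define \<mu> where "\<mu> = rate N h (2 * s)"
  define B where "B i = 2 * s * \<mu> ^ i" for i
  have \<theta>: "0 < \<theta>" "\<theta> < 1" using half_root_bounds[OF N] by (auto simp: \<theta>_def)
  have \<mu>: "0 < \<mu>" unfolding \<mu>_def using rate_pos[of N "2 * s" h] N pos s by simp
  have B_pos: "0 < B i" for i using s \<mu> by (simp add: B_def)
  have B_top: "B N = h (2 * s)"
  proof -
    have "0 \<le> h (2 * s) / (2 * s)" using pos[of "2 * s"] s by simp
    then have "\<mu> ^ N = h (2 * s) / (2 * s)"
      unfolding \<mu>_def rate_def using N by (intro real_root_pow_pos2) auto
    then show ?thesis using s by (simp add: B_def)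
  qed
  have main: "v i r < B i" if r: "t\<^sub>0 \<le> r" "r \<le> t" "v 0 r \<le> 2 * s" and "i < N" for r i
  proof -
    have r0: "0 \<le> r" using r t by simp
    have \<Delta>: "(r - t\<^sub>0) + integral {t\<^sub>0..r} q \<le> quantum N / \<mu>"
      using clock_diff[OF q(1) t(1) r(1)] clock_mono[OF q, of r t] r r0 short
      by (simp add: \<mu>_def)
    have \<Delta>1: "r - t\<^sub>0 \<le> quantum N / \<mu>" "integral {t\<^sub>0..r} q \<le> quantum N / \<mu>"
      using \<Delta> r integral_nonneg_of_locally_integrable[OF q t(1), of r] by auto
    have inc: "v i r < B i" if "i < N" and inc': "v i r - v i t\<^sub>0 \<le> quantum N / \<mu> * B (Suc i)" for i
    proof -
      have "v i t\<^sub>0 \<le> \<theta> * B i"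
        using start[OF that(1)] profile_double[OF N mono pos s that(1)]
        by (simp add: \<theta>_def B_def \<mu>_def)
      moreover have "quantum N / \<mu> * B (Suc i) = quantum N * B i"
        using \<mu> by (simp add: B_def field_simps)
      ultimately have "v i r \<le> (\<theta> + quantum N) * B i" using inc' by (simp add: algebra_simps)
      also have "\<dots> < 1 * B i"
        using B_pos[of i] \<theta> by (intro mult_strict_right_mono) (simp_all add: quantum_def \<theta>_def field_simps)
      finally show ?thesis by simp
    qed
    have "i \<le> N - 1" using \<open>i < N\<close> by simp
    then show ?thesis
    proof (induction i rule: inc_induct)
      case base
      have "0 \<le> v 0 r" using cascade_nonneg[OF v _ a r0] N by simp
      then have "0 \<le> h (v 0 r)" "h (v 0 r) \<le> h (2 * s)"
        using mono_onD[OF mono, of "v 0 r" "2 * s"] r(3) s h0 by auto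
      then have "integral {t\<^sub>0..r} q * h (v 0 r) \<le> quantum N / \<mu> * h (2 * s)"
        using \<Delta>1 integral_nonneg_of_locally_integrable[OF q t(1), of r]
        by (intro mult_mono) auto
      then show ?case
        using inc[of "N - 1"] cascadeD(5)[OF v t(1) r(1)] N B_top by simp
    next
      case (step n)
      have n: "Suc n < N" using step.hyps by simp
      have "v n r - v n t\<^sub>0 \<le> (r - t\<^sub>0) * v (Suc n) r"
        by (rule cascadeD(4)[OF v n t(1) r(1)])
      also have "\<dots> \<le> quantum N / \<mu> * B (Suc n)"
        using step.IH \<Delta>1 r cascade_nonneg[OF v n a[OF n] r0]
        by (intro mult_mono) auto
      finally show ?case using inc[of n] n by simp
    qed
  qed
  \<comment> \<open>At a time with \<open>v\<^sub>0 = 2 s\<close> the bound \<open>main\<close> would give \<open>v\<^sub>0 < B\<^sub>0 = 2 s\<close>.\<close>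
  have "v 0 t \<le> 2 * s"
  proof (rule ccontr)
    assume "\<not> v 0 t \<le> 2 * s"
    moreover have "v 0 t\<^sub>0 \<le> 2 * s" using start[of 0] N s by simp
    moreover have "continuous_on {t\<^sub>0..t} (v 0)"
      using cascadeD(1)[OF v, of 0] N t by (auto elim: continuous_on_subset)
    ultimately obtain r where r: "t\<^sub>0 \<le> r" "r \<le> t" "v 0 r = 2 * s"
      using IVT'[of "v 0" t\<^sub>0 "2 * s" t] t by auto
    then show False using main[of r 0] N by (simp add: B_def)
  qed
  then show ?thesis using main[of t i] t i by (simp add: B_def \<mu>_def)
qed

text \<open>
  The bound at scale \<open>2\<^sup>p\<^sup>+\<^sup>j\<close> holds until the clock shows the \<open>j\<close>-th partial sum of a divergent
  series, so after finitely many doublings it holds until \<open>T\<close>. Their number depends on the data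
  alone, which makes the bound uniform over all cascades.
\<close>

lemma cascade_top_bounded:
  assumes N: "1 \<le> N" and mono: "mono_on {0..} h" and pos: "\<And>s. 0 < s \<Longrightarrow> 0 < h s"
    and h0: "\<And>s. 0 \<le> s \<Longrightarrow> 0 \<le> h s" and q: "locally_integrable q" "\<And>t. 0 \<le> t \<Longrightarrow> 0 \<le> q t"
    and a: "\<And>i. i < N \<Longrightarrow> 0 \<le> a i"
    and div: "\<not> summable (\<lambda>j. 1 / rate N h (2 ^ j))" and T: "0 \<le> T"
  shows "\<exists>M. \<forall>v. cascade N 0 q h a v \<longrightarrow> (\<forall>i<N. v i T \<le> M)"
proof -
  obtain p where p: "\<And>i. i < N \<Longrightarrow> a i \<le> 2 ^ p * rate N h (2 ^ p) ^ i"
    using ex_dyadic_profile_ge[OF N mono pos] by blast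
  \<comment> \<open>The clock advance allowed for the doubling from \<open>2\<^sup>p\<^sup>+\<^sup>j\<close> to \<open>2\<^sup>p\<^sup>+\<^sup>j\<^sup>+\<^sup>1\<close>.\<close>
  define d where "d j = quantum N / rate N h (2 ^ Suc (p + j))" for j
  define \<tau> where "\<tau> j = (\<Sum>l<j. d l)" for j
  have st: "0 < quantum N" using half_root_bounds[OF N] by (simp add: quantum_def)
  have d_pos: "0 < d j" for j
    unfolding d_def using rate_pos[of N "2 ^ Suc (p + j)" h] N st pos by simp
  have "\<not> summable d"
  proof
    assume "summable d"
    then have "summable (\<lambda>j. 1 / quantum N * d j)" by (rule summable_mult)
    then have "summable (\<lambda>j. 1 / rate N h (2 ^ (j + Suc p)))"
      using st by (simp add: d_def add.commute)
    then show False using div summable_iff_shift[of "\<lambda>j. 1 / rate N h (2 ^ j)" "Suc p"] by simp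
  qed
  have "\<exists>j. clock q T \<le> \<tau> j"
  proof (rule ccontr)
    assume "\<not> ?thesis"
    then have "\<tau> j \<le> clock q T" for j by (meson linear)
    then have "summable d"
      using d_pos by (intro summableI_nonneg_bounded[of d "clock q T"]) (auto simp: \<tau>_def less_imp_le)
    then show False using \<open>\<not> summable d\<close> by blast
  qed
  then obtain J where J: "clock q T \<le> \<tau> J" ..
  have bound: "v i t \<le> 2 ^ (p + j) * rate N h (2 ^ (p + j)) ^ i"
    if v: "cascade N 0 q h a v" and "0 \<le> t" "clock q t \<le> \<tau> j" "i < N" for v j t i
    using that(2-)
  proof (induction j arbitrary: t i)
    case 0
    have "t \<le> 0"
      using 0 integral_nonneg_of_locally_integrable[OF q, of 0 t] by (simp add: \<tau>_def clock_def)
    then have "t = 0" using 0 by simp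
    then show ?case using p[OF 0(3)] cascadeD(3)[OF v 0(3)] by simp
  next
    case (Suc j)
    have c0: "clock q 0 \<le> \<tau> j" by (simp add: clock_def \<tau>_def sum_nonneg d_pos less_imp_le)
    have "\<exists>t0. 0 \<le> t0 \<and> t0 \<le> t \<and> clock q t0 \<le> \<tau> j \<and> clock q t - clock q t0 \<le> d j"
    proof (cases "clock q t \<le> \<tau> j")
      case True
      then show ?thesis using Suc.prems d_pos[of j] by (intro exI[of _ t]) auto
    next
      case False
      then obtain t0 where "0 \<le> t0" "t0 \<le> t" "clock q t0 = \<tau> j"
        using IVT'[of "clock q" 0 "\<tau> j" t] c0 Suc.prems clock_continuous[OF q(1), of t] by auto
      then show ?thesis using Suc.prems by (intro exI[of _ t0]) (simp add: \<tau>_def)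
    qed
    then obtain t0 where t0: "0 \<le> t0" "t0 \<le> t" "clock q t0 \<le> \<tau> j" "clock q t - clock q t0 \<le> d j"
      by blast
    show ?case
      using cascade_step[OF N mono pos h0 q v a, of "2 ^ (p + j)" t0 t i] Suc.IH[OF t0(1,3)] t0 Suc.prems
      by (simp add: d_def)
  qed
  have "v i T \<le> (\<Sum>i<N. 2 ^ (p + J) * rate N h (2 ^ (p + J)) ^ i)"
    if "cascade N 0 q h a v" "i < N" for v i
  proof -
    have "v i T \<le> 2 ^ (p + J) * rate N h (2 ^ (p + J)) ^ i" using bound[OF that(1) T J that(2)] .
    also have "\<dots> \<le> (\<Sum>i<N. 2 ^ (p + J) * rate N h (2 ^ (p + J)) ^ i)"
      using that(2) rate_pos[of N "2 ^ (p + J)" h] N pos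
      by (intro member_le_sum) (auto simp: less_imp_le)
    finally show ?thesis .
  qed
  then show ?thesis by blast
qed

text \<open>
  Below the \<open>k\<close>-th component no nonlinearity acts: component \<open>i\<close> is bounded by its initial value
  plus \<open>T\<close> times the bound of component \<open>i + 1\<close>.
\<close>

lemma cascade_bounded:
  assumes k: "k < m" and mono: "mono_on {0..} h" and pos: "\<And>s. 0 < s \<Longrightarrow> 0 < h s"
    and h0: "\<And>s. 0 \<le> s \<Longrightarrow> 0 \<le> h s" and q: "locally_integrable q" "\<And>t. 0 \<le> t \<Longrightarrow> 0 \<le> q t"
    and a: "\<And>i. i < m \<Longrightarrow> 0 \<le> a i"
    and div: "\<not> summable (\<lambda>j. 1 / rate (m - k) h (2 ^ j))" and T: "0 \<le> T"
  shows "\<exists>M. \<forall>u. cascade m k q h a u \<longrightarrow> (\<forall>i<m. u i T \<le> M)"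
proof -
  have "\<exists>M. \<forall>v. cascade (m - k) 0 q h (\<lambda>i. a (k + i)) v \<longrightarrow> (\<forall>i<m - k. v i T \<le> M)"
    using k a by (intro cascade_top_bounded[OF _ mono pos h0 q _ div T]) auto
  then obtain M where M: "\<And>v i. cascade (m - k) 0 q h (\<lambda>i. a (k + i)) v \<Longrightarrow> i < m - k \<Longrightarrow> v i T \<le> M"
    by blast
  have upper: "u i T \<le> M" if u: "cascade m k q h a u" and "k \<le> i" "i < m" for u i
    using M[OF cascade_drop[OF u k], of "i - k"] that by simp
  have low: "\<exists>M. \<forall>u. cascade m k q h a u \<longrightarrow> (\<forall>i. l \<le> i \<and> i < m \<longrightarrow> u i T \<le> M)" if "l \<le> k" for l
    using that
  proof (induction l rule: inc_induct)
    case base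
    show ?case using upper by (intro exI[of _ M]) simp
  next
    case (step n)
    then obtain M' where M': "\<And>u i. cascade m k q h a u \<Longrightarrow> Suc n \<le> i \<Longrightarrow> i < m \<Longrightarrow> u i T \<le> M'"
      by blast
    have "u i T \<le> max M' (a n + T * M')" if u: "cascade m k q h a u" and i: "n \<le> i" "i < m" for u i
    proof (cases "i = n")
      case True
      have n: "Suc n < m" using step.hyps k by simp
      have "u n T \<le> a n + T * u (Suc n) T"
        using cascadeD(4)[OF u n, of 0 T] cascadeD(3)[OF u, of n] n T by simp
      also have "\<dots> \<le> a n + T * M'" using M'[OF u _ n] T by (simp add: mult_left_mono)
      finally show ?thesis using True by simp
    next
      case False
      then show ?thesis using M'[OF u, of i] i by simp
    qed
    then show ?case by blast
  qed
  show ?thesis using low[of 0] by simp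
qed

section \<open>Polygonal approximations and their limit\<close>

lemma tendsto_pointwiseI:
  fixes X :: "'b \<Rightarrow> 'i \<Rightarrow> real"
  assumes "\<And>i. ((\<lambda>n. X n i) \<longlongrightarrow> x i) F"
  shows "(X \<longlongrightarrow> x) F"
proof -
  have "limitin (product_topology (\<lambda>i. euclidean) UNIV) X x F"
    using assms by (simp add: limitin_componentwise)
  then show ?thesis by (simp add: euclidean_product_topology)
qed

definition nonneg_orthant :: "nat \<Rightarrow> (nat \<Rightarrow> real) set" where
  "nonneg_orthant m = {x \<in> topspace (Euclidean_space m). \<forall>i<m. 0 \<le> x i}"

lemma nonneg_orthant_nonneg: "x \<in> nonneg_orthant m \<Longrightarrow> 0 \<le> x i"
  by (cases "i < m") (auto simp: nonneg_orthant_def topspace_Euclidean_space)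

lemma nonneg_orthant_zero: "x \<in> nonneg_orthant m \<Longrightarrow> m \<le> i \<Longrightarrow> x i = 0"
  by (auto simp: nonneg_orthant_def topspace_Euclidean_space)

text \<open>
  The right-hand side of the first order system equivalent to the equation of order \<open>m\<close>.
\<close>

definition companion ::
  "nat \<Rightarrow> (real \<Rightarrow> (nat \<Rightarrow> real) \<Rightarrow> real) \<Rightarrow> real \<Rightarrow> (nat \<Rightarrow> real) \<Rightarrow> nat \<Rightarrow> real" where
  "companion m f t x i = (if Suc i < m then x (Suc i) else if Suc i = m then f t x else 0)"

text \<open>
  The problem after modification of \<open>f\<close> on a null set of times, so that the conditions that hold
  almost everywhere hold at every \<open>t \<ge> 0\<close>. The integral condition on \<open>h\<close> enters in its dyadic
  form. Only the values of \<open>f\<close> on the non-negative orthant matter, because the approximations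
  never leave it.
\<close>

locale osgood_problem =
  fixes m k :: nat
    and f :: "real \<Rightarrow> (nat \<Rightarrow> real) \<Rightarrow> real"
    and q h :: "real \<Rightarrow> real"
    and a :: "nat \<Rightarrow> real"
  assumes k: "k < m"
    and f_measurable: "\<And>x. x \<in> nonneg_orthant m \<Longrightarrow> (\<lambda>t. f t x) \<in> borel_measurable (lebesgue_on {0..})"
    and f_continuous: "\<And>t. 0 \<le> t \<Longrightarrow> continuous_on (nonneg_orthant m) (f t)"
    and f_nonneg: "\<And>t x. 0 \<le> t \<Longrightarrow> x \<in> nonneg_orthant m \<Longrightarrow> 0 \<le> f t x"
    and f_le: "\<And>t x. 0 \<le> t \<Longrightarrow> x \<in> nonneg_orthant m \<Longrightarrow> f t x \<le> q t * h (x k)"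
    and q: "locally_integrable q" "\<And>t. 0 \<le> t \<Longrightarrow> 0 \<le> q t"
    and h_mono: "mono_on {0..} h"
    and h_nonneg: "\<And>s. 0 \<le> s \<Longrightarrow> 0 \<le> h s"
    and h_pos: "\<And>s. 0 < s \<Longrightarrow> 0 < h s"
    and divergence: "\<not> summable (\<lambda>j. 1 / rate (m - k) h (2 ^ j))"
    and a: "a \<in> nonneg_orthant m"
begin

abbreviation F :: "real \<Rightarrow> (nat \<Rightarrow> real) \<Rightarrow> nat \<Rightarrow> real" where
  "F \<equiv> companion m f"

lemma F_nonneg: "0 \<le> t \<Longrightarrow> x \<in> nonneg_orthant m \<Longrightarrow> 0 \<le> F t x i"
  by (simp add: companion_def nonneg_orthant_nonneg f_nonneg)

lemma F_integrable:
  assumes x: "x \<in> nonneg_orthant m" and s: "0 \<le> s"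
  shows "(\<lambda>t. F t x i) integrable_on {s..t}"
proof (cases "Suc i = m")
  case True
  have "(\<lambda>t. f t x) integrable_on {s..t}"
  proof (rule measurable_bounded_by_integrable_imp_integrable)
    show "(\<lambda>t. f t x) \<in> borel_measurable (lebesgue_on {s..t})"
      using f_measurable[OF x] by (rule measurable_restrict_mono) (use s in auto)
    show "(\<lambda>t. q t * h (x k)) integrable_on {s..t}"
      by (intro integrable_on_mult_left locally_integrable_imp_integrable[OF q(1) s])
    show "norm (f r x) \<le> q r * h (x k)" if "r \<in> {s..t}" for r
      using that s x f_nonneg[of r x] f_le[of r x] by simp
  qed simp
  then show ?thesis using True by (simp add: companion_def)
next
  case False
  then show ?thesis by (cases "Suc i < m") (simp_all add: companion_def integrable_const_ivl)
qed

text \<open>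
  Euler's method with mesh \<open>d\<close>, exact in the time variable. The state is constant on each cell, so
  measurability of \<open>f\<close> in time for fixed states suffices to integrate.
\<close>

primrec node :: "real \<Rightarrow> nat \<Rightarrow> nat \<Rightarrow> real" where
  "node d 0 = a"
| "node d (Suc j) =
     (\<lambda>i. node d j i + integral {real j * d..real (Suc j) * d} (\<lambda>t. F t (node d j) i))"

definition frozen :: "real \<Rightarrow> real \<Rightarrow> nat \<Rightarrow> real" where
  "frozen d t = node d (nat \<lfloor>t / d\<rfloor>)"

definition euler :: "real \<Rightarrow> nat \<Rightarrow> real \<Rightarrow> real" where
  "euler d i t = a i + integral {0..t} (\<lambda>s. F s (frozen d s) i)"

lemma node_in_orthant:
  assumes d: "0 < d"
  shows "node d j \<in> nonneg_orthant m"
proof (induction j)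
  case (Suc j)
  have "0 \<le> integral {real j * d..real (Suc j) * d} (\<lambda>t. F t (node d j) i)" for i
    using d by (intro integral_nonneg F_integrable F_nonneg Suc) (auto intro: order_trans[rotated])
  then have "0 \<le> node d (Suc j) i" for i
    using nonneg_orthant_nonneg[OF Suc, of i] by simp
  moreover have "node d (Suc j) i = 0" if "m \<le> i" for i
    using nonneg_orthant_zero[OF Suc that] that by (simp add: companion_def)
  ultimately show ?case unfolding nonneg_orthant_def topspace_Euclidean_space by blast
qed (simp add: a)

lemma frozen_in_orthant: "0 < d \<Longrightarrow> frozen d t \<in> nonneg_orthant m"
  by (simp add: frozen_def node_in_orthant)

lemma frozen_on_cell:
  assumes "0 < d" "real j * d \<le> t" "t < real (Suc j) * d"
  shows "frozen d t = node d j"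
proof -
  have "\<lfloor>t / d\<rfloor> = int j"
    using assms by (intro floor_unique) (simp_all add: pos_le_divide_eq pos_divide_less_eq algebra_simps)
  then show ?thesis by (simp add: frozen_def)
qed

lemma ex_cell:
  assumes "0 < d" "0 \<le> t"
  obtains j where "real j * d \<le> t" "t < real (Suc j) * d"
proof
  have "0 \<le> t / d" using assms by simp
  then show "real (nat \<lfloor>t / d\<rfloor>) * d \<le> t" "t < real (Suc (nat \<lfloor>t / d\<rfloor>)) * d"
    using assms of_int_floor_le[of "t / d"] floor_correct[of "t / d"]
    by (simp_all add: field_simps del: of_int_floor_le)
qed

lemma euler_at_node:
  assumes d: "0 < d"
  shows "(\<lambda>s. F s (frozen d s) i) integrable_on {0..real j * d} \<and> euler d i (real j * d) = node d j i"
proof (induction j)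
  case 0
  show ?case using integrable_on_refl[of _ "0 :: real"] by (simp add: euler_def)
next
  case (Suc j)
  have le: "0 \<le> real j * d" "real j * d \<le> real (Suc j) * d" using d by (auto simp: algebra_simps)
  have "((\<lambda>s. F s (node d j) i) has_integral
      integral {real j * d..real (Suc j) * d} (\<lambda>s. F s (node d j) i)) {real j * d..real (Suc j) * d}"
    by (intro integrable_integral F_integrable node_in_orthant d le)
  then have cell: "((\<lambda>s. F s (frozen d s) i) has_integral
      integral {real j * d..real (Suc j) * d} (\<lambda>s. F s (node d j) i)) {real j * d..real (Suc j) * d}"
    by (rule has_integral_spike_finite[of "{real (Suc j) * d}", rotated 2])
      (use frozen_on_cell[OF d, of j] in auto)
  have int: "(\<lambda>s. F s (frozen d s) i) integrable_on {0..real (Suc j) * d}"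
    using Henstock_Kurzweil_Integration.integrable_combine[OF le] Suc.IH cell has_integral_integrable by blast
  then have "euler d i (real (Suc j) * d) = node d (Suc j) i"
    using Henstock_Kurzweil_Integration.integral_combine[OF le int] Suc.IH integral_unique[OF cell]
    by (simp add: euler_def)
  then show ?case using int by blast
qed

lemma frozen_integrable:
  assumes d: "0 < d" and s: "0 \<le> s"
  shows "(\<lambda>s. F s (frozen d s) i) integrable_on {s..t}"
proof -
  obtain j where "max 0 t < real (Suc j) * d" using ex_cell[OF d, of "max 0 t"] by auto
  then have "{s..t} \<subseteq> {0..real (Suc j) * d}" using s by auto
  with conjunct1[OF euler_at_node[OF d, of i "Suc j"]] show ?thesis
    by (rule integrable_on_subinterval)
qed

lemma euler_diff:
  assumes "0 < d" "0 \<le> s" "s \<le> t"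
  shows "euler d i t - euler d i s = integral {s..t} (\<lambda>s. F s (frozen d s) i)"
  using Henstock_Kurzweil_Integration.integral_combine[OF assms(2,3) frozen_integrable[OF assms(1), of 0 i t]]
  by (simp add: euler_def)

lemma euler_mono:
  assumes "0 < d" "0 \<le> s" "s \<le> t"
  shows "euler d i s \<le> euler d i t"
proof -
  have "0 \<le> integral {s..t} (\<lambda>s. F s (frozen d s) i)"
    using assms by (intro integral_nonneg frozen_integrable F_nonneg frozen_in_orthant) auto
  then show ?thesis using euler_diff[OF assms, of i] by simp
qed

text \<open>
  The polygon passes through its nodes, so \<open>r\<close> can be the last grid point up to \<open>t\<close>.
\<close>

lemma frozen_eq_euler:
  assumes d: "0 < d" and t: "0 \<le> t"
  obtains r where "0 \<le> r" "t - d < r" "r \<le> t" "\<And>i. frozen d t i = euler d i r"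
proof -
  obtain j where j: "real j * d \<le> t" "t < real (Suc j) * d" using ex_cell[OF d t] by blast
  show thesis
    by (rule that[of "real j * d"])
      (use d j frozen_on_cell[OF d j] euler_at_node[OF d, of _ j] in \<open>auto simp: algebra_simps\<close>)
qed

lemma frozen_le_euler:
  assumes "0 < d" "0 \<le> s" "s \<le> t"
  shows "frozen d s i \<le> euler d i t"
  using frozen_eq_euler[OF assms(1,2)] euler_mono[OF assms(1)] assms(3) by (metis order_trans)

lemma euler_nonneg:
  assumes "0 < d" "0 \<le> t"
  shows "0 \<le> euler d i t"
  using frozen_le_euler[OF assms order_refl, of i] nonneg_orthant_nonneg[OF frozen_in_orthant[OF assms(1)], of t i]
  by linarith

lemma F_frozen_le:
  assumes d: "0 < d" and s: "0 \<le> s" "s \<le> t"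
  shows "Suc i < m \<Longrightarrow> F s (frozen d s) i \<le> euler d (Suc i) t"
    and "Suc i = m \<Longrightarrow> F s (frozen d s) i \<le> q s * h (euler d k t)"
proof -
  show "F s (frozen d s) i \<le> euler d (Suc i) t" if "Suc i < m"
    using that frozen_le_euler[OF assms] by (simp add: companion_def)
  have "f s (frozen d s) \<le> q s * h (frozen d s k)" using f_le[OF s(1) frozen_in_orthant[OF d]] .
  also have "\<dots> \<le> q s * h (euler d k t)"
    using frozen_le_euler[OF assms, of k] nonneg_orthant_nonneg[OF frozen_in_orthant[OF d], of s k]
    by (intro mult_left_mono mono_onD[OF h_mono] q(2) s) auto
  finally show "F s (frozen d s) i \<le> q s * h (euler d k t)" if "Suc i = m"
    using that by (simp add: companion_def)
qed

lemma euler_continuous: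
  assumes "0 < d"
  shows "continuous_on {0..} (euler d i)"
  unfolding euler_def
  by (intro continuous_on_Ici continuous_intros indefinite_integral_continuous_1 frozen_integrable[OF assms])
    simp

text \<open>
  This is where monotonicity absorbs the delay: the frozen state at a time \<open>s \<le> t\<close> is an earlier
  value of the polygon, hence at most its value at \<open>t\<close>.
\<close>

lemma euler_cascade:
  assumes d: "0 < d"
  shows "cascade m k q h a (euler d)"
  unfolding cascade_def
proof (intro conjI allI impI)
  fix s t :: real
  assume st: "0 \<le> s" "s \<le> t"
  fix i
  assume i: "Suc i < m"
  have "integral {s..t} (\<lambda>s. F s (frozen d s) i) \<le> integral {s..t} (\<lambda>s. euler d (Suc i) t)"
    using st F_frozen_le(1)[OF d _ _ i]
    by (intro integral_le frozen_integrable d integrable_const_ivl) auto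
  then show "euler d i t - euler d i s \<le> (t - s) * euler d (Suc i) t"
    using euler_diff[OF d st, of i] st by simp
next
  fix s t :: real
  assume st: "0 \<le> s" "s \<le> t"
  have m: "Suc (m - 1) = m" using k by simp
  have "integral {s..t} (\<lambda>s. F s (frozen d s) (m - 1)) \<le> integral {s..t} (\<lambda>s. q s * h (euler d k t))"
    using st F_frozen_le(2)[OF d _ _ m]
    by (intro integral_le frozen_integrable d integrable_on_mult_left
        locally_integrable_imp_integrable[OF q(1)]) auto
  then show "euler d (m - 1) t - euler d (m - 1) s \<le> integral {s..t} q * h (euler d k t)"
    using euler_diff[OF d st, of "m - 1"] by simp
next
  fix i
  show "continuous_on {0..} (euler d i)" using euler_continuous[OF d] .
  show "mono_on {0..} (euler d i)" using euler_mono[OF d] by (auto intro: mono_onI)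
  show "euler d i 0 = a i" by (simp add: euler_def)
qed

lemma euler_beyond:
  assumes "m \<le> i"
  shows "euler d i t = 0"
  using assms nonneg_orthant_zero[OF a] by (simp add: euler_def companion_def)

lemma euler_bounded:
  assumes T: "0 \<le> T"
  obtains M where "0 \<le> M" "\<And>d i t. 0 < d \<Longrightarrow> 0 \<le> t \<Longrightarrow> t \<le> T \<Longrightarrow> euler d i t \<le> M"
proof -
  obtain M where M: "\<And>u i. cascade m k q h a u \<Longrightarrow> i < m \<Longrightarrow> u i T \<le> M"
    using cascade_bounded[OF k h_mono, of q a T, OF h_pos h_nonneg q nonneg_orthant_nonneg[OF a] divergence T] by blast
  show thesis
  proof (rule that[of "max 0 M"])
    fix d t :: real and i
    assume *: "0 < d" "0 \<le> t" "t \<le> T"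
    show "euler d i t \<le> max 0 M"
    proof (cases "i < m")
      case True
      then show ?thesis
        using euler_mono[OF *, of i] M[OF euler_cascade[OF *(1)] True] by linarith
    qed (simp add: euler_beyond)
  qed simp
qed

text \<open>
  On \<open>[0, T]\<close> the slope of every polygon is at most \<open>M\<close> or \<open>q h(M)\<close>, where \<open>M\<close> is the a priori bound.
  So \<open>M + h(M)\<close> is a Lipschitz constant with respect to the clock, for all meshes at once.
\<close>

lemma euler_equicontinuous:
  assumes T: "0 \<le> T"
  obtains L where "0 \<le> L"
    "\<And>d i s t. 0 < d \<Longrightarrow> 0 \<le> s \<Longrightarrow> s \<le> t \<Longrightarrow> t \<le> T \<Longrightarrow>
       euler d i t - euler d i s \<le> L * (clock q t - clock q s)"
proof -
  obtain M where M: "0 \<le> M" "\<And>d i t. 0 < d \<Longrightarrow> 0 \<le> t \<Longrightarrow> t \<le> T \<Longrightarrow> euler d i t \<le> M"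
    using euler_bounded[OF T] by blast
  have hM: "0 \<le> h M" using h_nonneg[OF M(1)] .
  show thesis
  proof (rule that[of "M + h M"])
    fix d s t :: real and i
    assume d: "0 < d" and st: "0 \<le> s" "s \<le> t" and tT: "t \<le> T"
    have q0: "0 \<le> integral {s..t} q" using integral_nonneg_of_locally_integrable[OF q st(1)] .
    have "euler d i t - euler d i s \<le> M * (t - s) + h M * integral {s..t} q"
    proof -
      consider "Suc i < m" | "i = m - 1" | "m \<le> i" by linarith
      then show ?thesis
      proof cases
        case 1
        have "euler d i t - euler d i s \<le> (t - s) * euler d (Suc i) t"
          by (rule cascadeD(4)[OF euler_cascade[OF d] 1 st])
        also have "\<dots> \<le> (t - s) * M" using M(2)[OF d _ tT] st by (intro mult_left_mono) auto
        finally show ?thesis using mult_nonneg_nonneg[OF hM q0] by (simp add: mult.commute)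
      next
        case 2
        have t0: "0 \<le> t" using st by simp
        have "euler d i t - euler d i s \<le> integral {s..t} q * h (euler d k t)"
          unfolding 2 by (rule cascadeD(5)[OF euler_cascade[OF d] st])
        also have "\<dots> \<le> integral {s..t} q * h M"
          using M(2)[OF d t0 tT] euler_nonneg[OF d t0] M(1) q0
          by (intro mult_left_mono mono_onD[OF h_mono]) auto
        finally show ?thesis
          using mult_nonneg_nonneg[OF M(1), of "t - s"] st by (simp add: mult.commute)
      next
        case 3
        then show ?thesis using hM q0 M(1) st by (simp add: euler_beyond)
      qed
    qed
    also have "\<dots> \<le> (M + h M) * ((t - s) + integral {s..t} q)"
      using mult_nonneg_nonneg[OF M(1) q0] mult_nonneg_nonneg[OF hM, of "t - s"] st
      by (simp add: algebra_simps)
    finally show "euler d i t - euler d i s \<le> (M + h M) * (clock q t - clock q s)"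
      using clock_diff[OF q(1) st] by simp
  qed (use M(1) hM in simp)
qed

text \<open>
  A diagonal argument gives convergence at all rational times. Equicontinuity extends it to all
  \<open>t \<ge> 0\<close>. The subsequence principle wants one bound for the whole countable index set, so the
  polygons are divided by their time-dependent bound \<open>B t\<close> first.
\<close>

lemma euler_subsequence:
  obtains r where "strict_mono (r :: nat \<Rightarrow> nat)"
    "\<And>i t. 0 \<le> t \<Longrightarrow> convergent (\<lambda>n. euler (inverse (real (Suc (r n)))) i t)"
proof -
  define u where "u n i t = euler (inverse (real (Suc n))) i t" for n i t
  have mesh: "0 < inverse (real (Suc n))" for n by simp
  have "\<forall>t. \<exists>M>0. 0 \<le> t \<longrightarrow> (\<forall>n i. u n i t \<le> M)"
  proof
    fix t
    show "\<exists>M>0. 0 \<le> t \<longrightarrow> (\<forall>n i. u n i t \<le> M)"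
    proof (cases "0 \<le> t")
      case True
      then obtain M where "0 \<le> M" "\<And>d i s. 0 < d \<Longrightarrow> 0 \<le> s \<Longrightarrow> s \<le> t \<Longrightarrow> euler d i s \<le> M"
        using euler_bounded by blast
      then have "u n i t \<le> M + 1" for n i
        unfolding u_def using mesh[of n] True by (smt (verit))
      then show ?thesis using \<open>0 \<le> M\<close> by (intro exI[of _ "M + 1"]) auto
    qed (auto intro: exI[of _ 1])
  qed
  then obtain B where B: "\<And>t. 0 < B t" "\<And>n i t. 0 \<le> t \<Longrightarrow> u n i t \<le> B t" by metis
  have "countable (UNIV \<times> (\<rat> \<inter> {0..}) :: (nat \<times> real) set)"
    by (intro countable_SIGMA countableI_type countable_Int1 countable_rat)
  moreover have "norm ((\<lambda>(i, t). u n i t / B t) p) \<le> 1" if pS: "p \<in> UNIV \<times> (\<rat> \<inter> {0..})" for n p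
  proof -
    obtain i t where p: "p = (i, t)" "0 \<le> t" using pS by (cases p) auto
    then have "0 \<le> u n i t" "u n i t \<le> B t" using B(2) euler_nonneg[OF mesh[of n]] by (auto simp: u_def)
    then show ?thesis using B(1)[of t] p by (simp add: abs_of_nonneg divide_le_eq_1)
  qed
  ultimately obtain r where r: "strict_mono (r :: nat \<Rightarrow> nat)"
    "\<And>p. p \<in> UNIV \<times> (\<rat> \<inter> {0..}) \<Longrightarrow> \<exists>l. (\<lambda>n. (\<lambda>(i, t). u (r n) i t / B t) p) \<longlonglongrightarrow> l"
    using function_convergent_subsequence[of "UNIV \<times> (\<rat> \<inter> {0..})" "\<lambda>n (i, t). u n i t / B t" 1] by blast
  have rat: "Cauchy (\<lambda>n. u (r n) i p)" if p: "p \<in> \<rat>" "0 \<le> p" for i p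
  proof -
    obtain l where "(\<lambda>n. u (r n) i p / B p) \<longlonglongrightarrow> l" using r(2)[of "(i, p)"] p by auto
    then have "(\<lambda>n. B p * (u (r n) i p / B p)) \<longlonglongrightarrow> B p * l" by (rule tendsto_mult_left)
    then have "(\<lambda>n. u (r n) i p) \<longlonglongrightarrow> B p * l" using B(1)[of p] by simp
    then show ?thesis by (rule LIMSEQ_imp_Cauchy)
  qed
  have "Cauchy (\<lambda>n. u (r n) i t)" if t: "0 \<le> t" for i t
  proof (rule metric_CauchyI)
    fix e :: real
    assume "0 < e"
    obtain L where L: "0 \<le> L" "\<And>d i s' t'. 0 < d \<Longrightarrow> 0 \<le> s' \<Longrightarrow> s' \<le> t' \<Longrightarrow> t' \<le> t + 1 \<Longrightarrow>
       euler d i t' - euler d i s' \<le> L * (clock q t' - clock q s')"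
      using euler_equicontinuous[of "t + 1"] t by auto
    have "\<forall>e>0. \<exists>\<delta>>0. \<forall>p\<in>{0..t + 1}. dist p t < \<delta> \<longrightarrow> dist (clock q p) (clock q t) < e"
      by (rule bspec[OF iffD1[OF continuous_on_iff clock_continuous[OF q(1)]]]) (use t in simp)
    moreover have "0 < e / (3 * (L + 1))" using \<open>0 < e\<close> L(1) by simp
    ultimately obtain \<delta> where \<delta>: "0 < \<delta>"
      "\<And>p. p \<in> {0..t + 1} \<Longrightarrow> dist p t < \<delta> \<Longrightarrow> dist (clock q p) (clock q t) < e / (3 * (L + 1))"
      by blast
    \<comment> \<open>Rational times are taken to the right of \<open>t\<close> so that they stay in the half-line even for \<open>t = 0\<close>.\<close>
    obtain p where p: "p \<in> \<rat>" "t < p" "p < min (t + \<delta>) (t + 1)"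
      using Rats_dense_in_real[of t "min (t + \<delta>) (t + 1)"] \<delta>(1) by auto
    have "clock q p - clock q t < e / (3 * (L + 1))"
      using \<delta>(2)[of p] p t by (auto simp: dist_real_def)
    then have "(L + 1) * (clock q p - clock q t) < e / 3"
      using L(1) pos_less_divide_eq[of "3 * (L + 1)" "clock q p - clock q t" e] by (simp only: mult.commute)
        argo
    moreover have "clock q t \<le> clock q p" using p t by (intro clock_mono[OF q]) auto
    ultimately have small: "L * (clock q p - clock q t) < e / 3"
      by (simp add: algebra_simps)
    have near: "dist (u n i p) (u n i t) < e / 3" for n
      using L(2)[OF mesh[of n] t, of p i] euler_mono[OF mesh[of n] t, of p i] p small
      unfolding u_def dist_real_def by auto
    obtain N where N: "\<And>n n'. N \<le> n \<Longrightarrow> N \<le> n' \<Longrightarrow> dist (u (r n) i p) (u (r n') i p) < e / 3"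
      using metric_CauchyD[OF rat[OF p(1)], of "e / 3" i] p t \<open>0 < e\<close> by auto
    show "\<exists>N. \<forall>n\<ge>N. \<forall>n'\<ge>N. dist (u (r n) i t) (u (r n') i t) < e"
    proof (intro exI[of _ N] allI impI)
      fix n n'
      assume "N \<le> n" "N \<le> n'"
      then show "dist (u (r n) i t) (u (r n') i t) < e"
        using N[of n n'] near[of "r n"] near[of "r n'"] unfolding dist_real_def by linarith
    qed
  qed
  then show thesis using r(1) by (intro that) (auto simp: u_def Cauchy_convergent_iff)
qed

lemma frozen_tendsto:
  assumes t: "0 \<le> t" and d: "\<And>n. 0 < d n" "d \<longlonglongrightarrow> 0"
    and u: "(\<lambda>n. euler (d n) i t) \<longlonglongrightarrow> l"
  shows "(\<lambda>n. frozen (d n) t i) \<longlonglongrightarrow> l"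
proof -
  obtain L where L: "0 \<le> L" "\<And>d i r. 0 < d \<Longrightarrow> 0 \<le> r \<Longrightarrow> r \<le> t \<Longrightarrow>
       euler d i t - euler d i r \<le> L * (clock q t - clock q r)"
    using euler_equicontinuous[OF t] by (metis order_refl)
  have "\<forall>n. \<exists>r. 0 \<le> r \<and> t - d n < r \<and> r \<le> t \<and> frozen (d n) t i = euler (d n) i r"
    using frozen_eq_euler[OF d(1) t] by metis
  then obtain r where r: "\<And>n. 0 \<le> r n" "\<And>n. t - d n < r n" "\<And>n. r n \<le> t"
    "\<And>n. frozen (d n) t i = euler (d n) i (r n)" by metis
  have "r \<longlonglongrightarrow> t"
  proof (rule tendsto_sandwich)
    show "(\<lambda>n. t - d n) \<longlonglongrightarrow> t" using tendsto_diff[OF tendsto_const d(2), of t] by simp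
    show "(\<lambda>n. t) \<longlonglongrightarrow> t" by simp
  qed (use r in \<open>auto intro!: always_eventually less_imp_le\<close>)
  then have "(\<lambda>n. clock q (r n)) \<longlonglongrightarrow> clock q t"
    by (rule continuous_on_tendsto_compose[OF clock_continuous[OF q(1), of t]]) (use r t in auto)
  then have z: "(\<lambda>n. L * (clock q t - clock q (r n))) \<longlonglongrightarrow> L * (clock q t - clock q t)"
    by (intro tendsto_intros)
  have "(\<lambda>n. euler (d n) i t - frozen (d n) t i) \<longlonglongrightarrow> 0"
  proof (rule tendsto_sandwich)
    show "\<forall>\<^sub>F n in sequentially. 0 \<le> euler (d n) i t - frozen (d n) t i"
      using euler_mono[OF d(1) r(1,3)] by (intro always_eventually) (simp add: r(4))
    show "\<forall>\<^sub>F n in sequentially. euler (d n) i t - frozen (d n) t i \<le> L * (clock q t - clock q (r n))"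
      using L(2)[OF d(1) r(1,3)] by (intro always_eventually) (simp add: r(4))
  qed (use z in auto)
  from tendsto_diff[OF u this] show ?thesis by simp
qed

text \<open>
  Both the polygons and their frozen states converge to the same limit. Continuity of \<open>f\<close> in the
  state carries this over to the integrands, which are dominated by \<open>M + q h(M)\<close>.
\<close>

lemma integral_equation_solvable:
  obtains x where
    "\<And>t. 0 \<le> t \<Longrightarrow> (\<lambda>i. x i t) \<in> nonneg_orthant m"
    "\<And>i t. 0 \<le> t \<Longrightarrow> (\<lambda>s. F s (\<lambda>i. x i s) i) integrable_on {0..t}"
    "\<And>i t. 0 \<le> t \<Longrightarrow> x i t = a i + integral {0..t} (\<lambda>s. F s (\<lambda>i. x i s) i)"
proof -
  obtain r where r: "strict_mono (r :: nat \<Rightarrow> nat)"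
    "\<And>i t. 0 \<le> t \<Longrightarrow> convergent (\<lambda>n. euler (inverse (real (Suc (r n)))) i t)"
    using euler_subsequence by blast
  define d where "d n = inverse (real (Suc (r n)))" for n
  have d: "0 < d n" for n by (simp add: d_def)
  have d0: "d \<longlonglongrightarrow> 0"
    using LIMSEQ_subseq_LIMSEQ[OF LIMSEQ_inverse_real_of_nat r(1)] by (simp add: d_def[abs_def] o_def)
  define x where "x i t = lim (\<lambda>n. euler (d n) i t)" for i t
  have u_lim: "(\<lambda>n. euler (d n) i t) \<longlonglongrightarrow> x i t" if "0 \<le> t" for i t
    using r(2)[OF that] by (simp add: x_def d_def convergent_LIMSEQ_iff)
  have x_orthant: "(\<lambda>i. x i t) \<in> nonneg_orthant m" if "0 \<le> t" for t
  proof -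
    have "0 \<le> x i t" for i
      by (rule LIMSEQ_le_const[OF u_lim[OF that]]) (simp add: euler_nonneg[OF d that])
    moreover have "x i t = 0" if "m \<le> i" for i
      using u_lim[OF \<open>0 \<le> t\<close>, of i] LIMSEQ_unique[OF _ tendsto_const] by (simp add: euler_beyond that)
    ultimately show ?thesis by (auto simp: nonneg_orthant_def topspace_Euclidean_space)
  qed
  have fz_lim: "(\<lambda>n. frozen (d n) s i) \<longlonglongrightarrow> x i s" if "0 \<le> s" for s i
    by (rule frozen_tendsto[OF that d d0 u_lim[OF that]])
  have F_lim: "(\<lambda>n. F s (frozen (d n) s) i) \<longlonglongrightarrow> F s (\<lambda>i. x i s) i" if s: "0 \<le> s" for s i
  proof -
    have "(\<lambda>n. f s (frozen (d n) s)) \<longlonglongrightarrow> f s (\<lambda>i. x i s)"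
      by (rule continuous_on_tendsto_compose[OF f_continuous[OF s]])
        (use tendsto_pointwiseI[OF fz_lim[OF s]] x_orthant[OF s] frozen_in_orthant[OF d] in auto)
    then show ?thesis using fz_lim[OF s] by (simp add: companion_def)
  qed
  have main: "(\<lambda>s. F s (\<lambda>i. x i s) i) integrable_on {0..t} \<and>
      x i t = a i + integral {0..t} (\<lambda>s. F s (\<lambda>i. x i s) i)" if t: "0 \<le> t" for i t
  proof -
    obtain M where M: "0 \<le> M" "\<And>d i s. 0 < d \<Longrightarrow> 0 \<le> s \<Longrightarrow> s \<le> t \<Longrightarrow> euler d i s \<le> M"
      using euler_bounded[OF t] by blast
    have le: "norm (F s (frozen (d n) s) i) \<le> M + q s * h M" if s: "s \<in> {0..t}" for n s
    proof -
      have s': "0 \<le> s" "s \<le> t" using s by auto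
      have hM: "h (euler (d n) k t) \<le> h M"
        using M(2)[OF d t] euler_nonneg[OF d t] M(1) by (intro mono_onD[OF h_mono]) auto
      have qh: "0 \<le> q s * h M" using q(2)[OF s'(1)] h_nonneg[OF M(1)] by simp
      consider "Suc i < m" | "Suc i = m" | "m < Suc i" by linarith
      then have "F s (frozen (d n) s) i \<le> M + q s * h M"
      proof cases
        case 1
        then show ?thesis using F_frozen_le(1)[OF d s' 1, of n] M(2)[OF d t, of n "Suc i"] qh by simp
      next
        case 2
        then show ?thesis
          using F_frozen_le(2)[OF d s' 2, of n] mult_left_mono[OF hM q(2)[OF s'(1)]] M(1) by linarith
      next
        case 3
        then show ?thesis using qh M(1) by (simp add: companion_def)
      qed
      then show ?thesis using F_nonneg[OF s'(1) frozen_in_orthant[OF d]] by simp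
    qed
    have dom: "(\<lambda>s. M + q s * h M) integrable_on {0..t}"
      by (intro integrable_add integrable_const_ivl integrable_on_mult_left
          locally_integrable_imp_integrable[OF q(1)]) simp
    have int: "(\<lambda>s. F s (frozen (d n) s) i) integrable_on {0..t}" for n
      by (rule frozen_integrable[OF d]) simp
    have "(\<lambda>s. F s (\<lambda>i. x i s) i) integrable_on {0..t}"
      by (rule dominated_convergence(1)[OF int dom le F_lim]) auto
    moreover have "(\<lambda>n. integral {0..t} (\<lambda>s. F s (frozen (d n) s) i)) \<longlonglongrightarrow>
        integral {0..t} (\<lambda>s. F s (\<lambda>i. x i s) i)"
      by (rule dominated_convergence(2)[OF int dom le F_lim]) auto
    then have "(\<lambda>n. euler (d n) i t) \<longlonglongrightarrow> a i + integral {0..t} (\<lambda>s. F s (\<lambda>i. x i s) i)"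
      unfolding euler_def by (intro tendsto_intros)
    ultimately show ?thesis using LIMSEQ_unique[OF u_lim[OF t]] by blast
  qed
  show thesis by (rule that[of x]) (use x_orthant main in blast)+
qed

end

section \<open>From the integral equation to the Cauchy problem\<close>

text \<open>
  All but the last component are continuously differentiable, as primitives of continuous
  functions. The last one is a primitive of a merely integrable function, hence absolutely
  continuous and differentiable almost everywhere.
\<close>

lemma solution_of_integral_equation:
  assumes m: "1 \<le> m"
    and orthant: "\<And>t. 0 \<le> t \<Longrightarrow> (\<lambda>i. x i t) \<in> nonneg_orthant m"
    and f_nonneg: "\<And>t x. 0 \<le> t \<Longrightarrow> x \<in> nonneg_orthant m \<Longrightarrow> 0 \<le> f t x"
    and int: "\<And>i t. 0 \<le> t \<Longrightarrow> (\<lambda>s. companion m f s (\<lambda>i. x i s) i) integrable_on {0..t}"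
    and eq: "\<And>i t. 0 \<le> t \<Longrightarrow> x i t = a i + integral {0..t} (\<lambda>s. companion m f s (\<lambda>i. x i s) i)"
  shows "is_Cauchy_solution m f a \<infinity> (x 0)"
proof -
  define g where "g i s = companion m f s (\<lambda>i. x i s) i" for i s
  have g_int: "g i integrable_on {s..t}" if "0 \<le> s" for i s t
  proof -
    have "g i integrable_on {0..\<bar>t\<bar>}" using int[of "\<bar>t\<bar>" i] by (simp add: g_def[abs_def])
    then show ?thesis by (rule integrable_on_subinterval) (use that in auto)
  qed
  have x_eq: "x i t = a i + integral {0..t} (g i)" if "0 \<le> t" for i t
    using eq[OF that, of i] by (simp add: g_def[abs_def])
  have x_diff: "x i t - x i s = integral {s..t} (g i)" if "0 \<le> s" "s \<le> t" for i s t
    by (rule primitive_diff[OF g_int x_eq that]) simp_all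
  have x_cont: "continuous_on {0..} (x i)" for i
  proof (rule continuous_on_Ici)
    fix b
    have "continuous_on {0..b} (\<lambda>t. a i + integral {0..t} (g i))"
      by (intro continuous_intros indefinite_integral_continuous_1 g_int) simp
    then show "continuous_on {0..b} (x i)"
      by (rule continuous_on_eq) (simp add: x_eq)
  qed
  have x_deriv: "(x i has_vector_derivative x (Suc i) t) (at t within {0..})"
    if i: "Suc i < m" and t: "0 \<le> t" for i t
  proof (rule primitive_has_vector_derivative[OF x_cont _ t])
    have "g i = x (Suc i)" using i by (auto simp: g_def companion_def)
    then show "x i t = a i + integral {0..t} (x (Suc i))" if "0 \<le> t" for t
      using x_eq[OF that, of i] by simp
  qed
  have nth: "nth_derivative_on {0..} i (x 0) t = x i t" if "i < m" "0 \<le> t" for i t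
    by (rule nth_derivative_on_Ici_eq[of m x, OF x_deriv that])
  have g_nonneg: "0 \<le> g i s" if "0 \<le> s" for i s
    using nonneg_orthant_nonneg[OF orthant[OF that]] f_nonneg[OF that orthant[OF that]] by (simp add: g_def companion_def)
  have "locally_abs_continuous_on {0..} (nth_derivative_on {0..} i (x 0))" if i: "i < m" for i
    unfolding locally_abs_continuous_on_def
  proof (intro allI impI)
    fix b c :: real
    assume bc: "{b..c} \<subseteq> {0..}"
    show "abs_continuous_on {b..c} (nth_derivative_on {0..} i (x 0))"
    proof (rule primitive_abs_continuous[where g = "g i"])
      show "g i absolutely_integrable_on {b..c}"
      proof (cases "b \<le> c")
        case True
        then have "0 \<le> b" using bc by auto
        then show ?thesis using g_nonneg by (intro nonnegative_absolutely_integrable_1 g_int) auto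
      qed simp
      fix s t
      assume "b \<le> s" "s \<le> t" "t \<le> c"
      then have "0 \<le> s" "0 \<le> t" using bc by auto
      then show "nth_derivative_on {0..} i (x 0) t - nth_derivative_on {0..} i (x 0) s = integral {s..t} (g i)"
        using x_diff \<open>s \<le> t\<close> i by (simp add: nth)
    qed
  qed
  moreover have "nth_derivative_on {0..} i (x 0) differentiable_on {0..}" if i: "Suc i < m" for i
    unfolding differentiable_on_def
  proof
    fix t :: real
    assume t: "t \<in> {0..}"
    have "(nth_derivative_on {0..} i (x 0) has_vector_derivative x (Suc i) t) (at t within {0..})"
      by (rule has_vector_derivative_transform[OF t _ x_deriv[OF i]]) (use t i nth in auto)
    then show "nth_derivative_on {0..} i (x 0) differentiable (at t within {0..})"
      by (rule differentiableI_vector)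
  qed
  moreover have "AE t in lebesgue_on {0..}. (nth_derivative_on {0..} (m - 1) (x 0)
      has_real_derivative f t (jet {0..} m (x 0) t)) (at t within {0..})"
  proof -
    have "AE t in lebesgue_on {0..}. (nth_derivative_on {0..} (m - 1) (x 0)
        has_real_derivative g (m - 1) t) (at t within {0..})"
      by (rule primitive_has_derivative_AE) (use g_int x_diff m in \<open>simp_all add: nth\<close>)
    moreover have "g (m - 1) t = f t (jet {0..} m (x 0) t)" if "0 \<le> t" for t
    proof -
      have "jet {0..} m (x 0) t = (\<lambda>i. x i t)"
        using nonneg_orthant_zero[OF orthant[OF that]] that by (auto simp: jet_def nth)
      then show ?thesis using m by (simp add: g_def companion_def)
    qed
    ultimately show ?thesis
      by (elim AE_mp) (intro AE_I2, simp)
  qed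
  moreover have "nth_derivative_on {0..} i (x 0) 0 = a i" if "i < m" for i
    using x_eq[of 0 i] by (simp add: nth that)
  moreover have "right_open_interval \<infinity> = {0..}" by (auto simp: right_open_interval_def)
  ultimately show ?thesis
    by (simp add: is_Cauchy_solution_def is_solution_def)
qed

text \<open>
  The exceptional null set must not depend on the state, since the solution is inserted there.
\<close>

lemma is_Cauchy_solution_cong_AE:
  assumes "is_Cauchy_solution m f a T w"
    and "AE t in lebesgue_on (right_open_interval T). \<forall>x. f t x = g t x"
  shows "is_Cauchy_solution m g a T w"
proof -
  have "AE t in lebesgue_on (right_open_interval T).
      (nth_derivative_on (right_open_interval T) (m - 1) w has_real_derivative
        f t (jet (right_open_interval T) m w t)) (at t within right_open_interval T)"
    using assms(1) by (simp add: is_Cauchy_solution_def is_solution_def Let_def)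
  with assms(2) have "AE t in lebesgue_on (right_open_interval T).
      (nth_derivative_on (right_open_interval T) (m - 1) w has_real_derivative
        g t (jet (right_open_interval T) m w t)) (at t within right_open_interval T)"
    by eventually_elim simp
  then show ?thesis using assms(1) by (simp add: is_Cauchy_solution_def is_solution_def Let_def)
qed

theorem theorem2:
  fixes m k :: nat
    and f :: "real \<Rightarrow> (nat \<Rightarrow> real) \<Rightarrow> real"
    and q h :: "real \<Rightarrow> real"
  assumes "1 \<le> m" and "k \<le> m - 1"
    and "\<And>t x. 0 \<le> t \<Longrightarrow> x \<in> topspace (Euclidean_space m) \<Longrightarrow> 0 \<le> f t x"
    and "locally_Caratheodory m f"
    and "\<And>t. 0 \<le> t \<Longrightarrow> 0 \<le> q t"
    and "locally_integrable q"
    and "\<And>s. 0 \<le> s \<Longrightarrow> 0 \<le> h s"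
    and "mono_on {0..} h"
    and "continuous_on {0..} h"
    and "\<And>s. 0 < s \<Longrightarrow> 0 < h s"
    and "AE t in lebesgue_on {0..}. \<forall>x\<in>topspace (Euclidean_space m).
           (\<forall>i<m. 0 \<le> x i) \<longrightarrow> f t x \<le> q t * h (x k)"
    and "(\<integral>\<^sup>+s\<in>{1..}. ennreal (h s powr (- (1 / real (m - k))) * s powr (1 / real (m - k) - 1))
           \<partial>lborel) = \<infinity>"
  shows "\<forall>a::nat \<Rightarrow> real. (\<forall>i<m. 0 \<le> a i) \<longrightarrow> (\<exists>w. is_Cauchy_solution m f a \<infinity> w)"
proof (intro allI impI)
  fix a :: "nat \<Rightarrow> real"
  assume a: "\<forall>i<m. 0 \<le> a i"
  \<comment> \<open>Points of the phase space vanish from index \<open>m\<close> on, while \<open>a\<close> is arbitrary there.\<close>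
  define b where "b i = (if i < m then a i else 0)" for i
  have k: "k < m" using assms(1,2) by simp
  have "AE t in lebesgue_on {0..}. continuous_map (Euclidean_space m) euclideanreal (f t)"
    using assms(4) by (simp add: locally_Caratheodory_def)
  with assms(11) have "AE t in lebesgue_on {0..}. continuous_on (nonneg_orthant m) (f t) \<and>
      (\<forall>x\<in>nonneg_orthant m. f t x \<le> q t * h (x k))"
    by eventually_elim
      (auto simp: continuous_map_Euclidean_space_iff nonneg_orthant_def elim: continuous_on_subset)
  then have "AE t in lebesgue. t \<in> {0..} \<longrightarrow> continuous_on (nonneg_orthant m) (f t) \<and>
      (\<forall>x\<in>nonneg_orthant m. f t x \<le> q t * h (x k))"
    by (subst (asm) AE_restrict_space_iff) simp_all
  then obtain Z where Z: "Z \<in> null_sets lebesgue"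
    and good: "\<And>t. t \<notin> Z \<Longrightarrow> 0 \<le> t \<Longrightarrow> continuous_on (nonneg_orthant m) (f t)"
      "\<And>t x. t \<notin> Z \<Longrightarrow> 0 \<le> t \<Longrightarrow> x \<in> nonneg_orthant m \<Longrightarrow> f t x \<le> q t * h (x k)"
    unfolding eventually_ae_filter by auto
  \<comment> \<open>The value \<open>0\<close> on the exceptional set satisfies all conditions, including the growth bound.\<close>
  define f' where "f' t x = (if t \<in> Z then 0 else f t x)" for t and x :: "nat \<Rightarrow> real"
  interpret osgood_problem m k f' q h b
  proof
    fix x
    assume x: "x \<in> nonneg_orthant m"
    have "Z \<inter> space (lebesgue_on {0..}) \<in> sets (lebesgue_on {0..})"
      using Z by (simp add: sets_restrict_space_iff null_setsD2 sets.Int)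
    moreover have "(\<lambda>t. f t x) \<in> borel_measurable (lebesgue_on {0..})"
      using assms(4) x by (simp add: locally_Caratheodory_def nonneg_orthant_def)
    ultimately show "(\<lambda>t. f' t x) \<in> borel_measurable (lebesgue_on {0..})"
      unfolding f'_def by (intro measurable_If_set) auto
  next
    show "continuous_on (nonneg_orthant m) (f' t)" if "0 \<le> t" for t
      using good(1)[OF _ that] by (cases "t \<in> Z") (simp_all add: f'_def[abs_def])
    show "0 \<le> f' t x" if "0 \<le> t" "x \<in> nonneg_orthant m" for t x
      using assms(3)[OF that(1), of x] that(2) by (simp add: f'_def nonneg_orthant_def)
    show "f' t x \<le> q t * h (x k)" if "0 \<le> t" "x \<in> nonneg_orthant m" for t x
      using good(2)[OF _ that] assms(5)[OF that(1)] assms(7)[OF nonneg_orthant_nonneg[OF that(2), of k]]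
      by (simp add: f'_def)
    show "\<not> summable (\<lambda>j. 1 / rate (m - k) h (2 ^ j))"
      using k by (intro inverse_rate_not_summable[OF _ assms(8,10,12)]) auto
    show "b \<in> nonneg_orthant m" using a by (simp add: b_def nonneg_orthant_def topspace_Euclidean_space)
  qed (use k assms(5-8,10) in auto)
  obtain x where x:
    "\<And>t. 0 \<le> t \<Longrightarrow> (\<lambda>i. x i t) \<in> nonneg_orthant m"
    "\<And>i t. 0 \<le> t \<Longrightarrow> (\<lambda>s. companion m f' s (\<lambda>i. x i s) i) integrable_on {0..t}"
    "\<And>i t. 0 \<le> t \<Longrightarrow> x i t = b i + integral {0..t} (\<lambda>s. companion m f' s (\<lambda>i. x i s) i)"
    using integral_equation_solvable by blast
  have "is_Cauchy_solution m f' b \<infinity> (x 0)"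
    by (rule solution_of_integral_equation[OF assms(1) x(1) f_nonneg x(2,3)])
  moreover have "AE t in lebesgue_on (right_open_interval \<infinity>). \<forall>x. f' t x = f t x"
    using Z by (intro AE_lebesgue_onI[of Z])
      (auto simp: negligible_iff_null_sets f'_def right_open_interval_def)
  ultimately have "is_Cauchy_solution m f b \<infinity> (x 0)" by (rule is_Cauchy_solution_cong_AE)
  then have "is_Cauchy_solution m f a \<infinity> (x 0)" by (simp add: is_Cauchy_solution_def b_def)
  then show "\<exists>w. is_Cauchy_solution m f a \<infinity> w" by (rule exI[of _ "x 0"])
qed

end
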